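(* Let $n\geq 0$ be an integer. The following properties hold: (i) the distributions of $A_n[\infty]$, $A^\ast_n[\infty]$ and $A^\dag_n[\infty]$ are invariant with respect to $\tau_k$, for every $k\in \mathbb{Z}$; (ii) the distributions of $A_n[\infty]$, $A^\ast_n[\infty]$ and $A^\dag_n[\infty]$ are invariant with respect to $S_{k/2}$, for every $k\in \mathbb{Z}$.
   Context: Let $(S_{i,j})_{i\in\mathbb{Z},j\geq1}$ be independent simple symmetric random walks on $\mathbb{Z}^2$, $S_{i,j}$ starting at $(0,i)$. When the current aggregate is $A\subset\mathbb{Z}^2$, sending particle $(i,j)$ (from level $i$) means: follow $S_{i,j}$ until the first time (possibly time $0$) it is at a site $z\notin A$; the particle stops there and the aggregate becomes $A\cup\{z\}$. $A_n[M]$ ($M\geq0$) is the aggregate obtained from $\emptyset$ by sending $n$ particles from each level $i$ with $|i|\le M$, levels being treated in the usual order $0,1,-1,2,-2,\dots,M,-M$; $A_n[\infty]=\bigcup_{M\geq0}A_n[M]$ (increasing union). Let $(N_i)_{i\in\mathbb{Z}}$ be i.i.d. Poisson random variables with parameter $n$, independent of the walks. $A_n^*[M]$ is obtained in the same usual order but sending $N_i$ particles from level $i$; $A_n^*[\infty]=\bigcup_{M\geq0}A_n^*[M]$. Let $(\mathcal{N}_i)_{i\in\mathbb{Z}}$ be i.i.d. Poisson point processes on $\mathbb{R}^+$ with intensity $1$, independent of the walks, and let $T_{i,1}<T_{i,2}<\dots$ be the points of $\mathcal{N}_i$. $A_n^\dag[M]$ is the aggregate obtained from $\emptyset$ by sending,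 in increasing order of the times $T_{i,j}$ (a.s. distinct), all particles $(i,j)$ with $|i|\leq M$ and $T_{i,j}\leq n$ (trajectories are realized instantaneously); $A_n^\dag[\infty]=\bigcup_{M\geq0}A_n^\dag[M]$. For $k\in\mathbb{Z}$, $\tau_k$ is the translation by the vector $(0,k)$, and $S_{k/2}$ is the symmetry with respect to the horizontal axis $\mathbb{R}\times\{k/2\}$, i.e. $(x,y)\mapsto(x,k-y)$. *)

theory Defs
  imports "HOL-Probability.Probability"
begin

section \<open>Internal diffusion limited aggregation from given trajectories\<close>

type_synonym site = "int \<times> int"
type_synonym particle = "int \<times> nat"

text \<open>A particle that never leaves the aggregate (an event of probability zero for a random walk
  and a finite aggregate) leaves it unchanged.\<close>

definition send :: "(nat \<Rightarrow> site) \<Rightarrow> site set \<Rightarrow> site set" where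
  "send w A = (if \<exists>t. w t \<notin> A then insert (w (LEAST t. w t \<notin> A)) A else A)"

definition aggregate :: "(particle \<Rightarrow> nat \<Rightarrow> site) \<Rightarrow> particle list \<Rightarrow> site set" where
  "aggregate w ps = fold (\<lambda>p A. send (w p) A) ps {}"

primrec levels :: "nat \<Rightarrow> int list" where
  "levels 0 = [0]"
| "levels (Suc M) = levels M @ [int (Suc M), - int (Suc M)]"

lemma set_levels: "set (levels M) = {i. \<bar>i\<bar> \<le> int M}"
  by (induction M) auto

text \<open>The particles \<open>(i, 1), \<dots>, (i, c i)\<close> of every level \<open>\<bar>i\<bar> \<le> M\<close>, in the usual order.\<close>

definition particles :: "(int \<Rightarrow> nat) \<Rightarrow> nat \<Rightarrow> particle list" where
  "particles c M = concat (map (\<lambda>i. map (Pair i) [1..<Suc (c i)]) (levels M))"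

lemma set_particles: "set (particles c M) = {(i, j). \<bar>i\<bar> \<le> int M \<and> 1 \<le> j \<and> j \<le> c i}"
  by (fastforce simp: particles_def set_levels less_Suc_eq_le image_iff simp del: upt_Suc)

section \<open>Configurations of points on the half-line\<close>

definition point_configs :: "real set set" where
  "point_configs = {X. X \<subseteq> {0..} \<and> (\<forall>t. finite (X \<inter> {..t}))}"

text \<open>The \<open>j\<close>-th smallest point of \<open>X\<close> for \<open>j \<ge> 1\<close>, with value \<open>\<infinity>\<close> if \<open>X\<close> has fewer than \<open>j\<close>
  points.\<close>

definition arrival :: "real set \<Rightarrow> nat \<Rightarrow> ereal" where
  "arrival X j = (INF t\<in>{t \<in> X. j \<le> card (X \<inter> {..t})}. ereal t)"

lemma arrival_le_iff:
  assumes X: "X \<in> point_configs" and j: "1 \<le> j"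
  shows "arrival X j \<le> ereal t \<longleftrightarrow> j \<le> card (X \<inter> {..t})"
proof
  have fin: "finite (X \<inter> {..s})" for s
    using X by (auto simp: point_configs_def)
  let ?Q = "{s \<in> X. j \<le> card (X \<inter> {..s})}"
  {
    assume le: "j \<le> card (X \<inter> {..t})"
    with j have ne: "X \<inter> {..t} \<noteq> {}" by auto
    define m where "m = Max (X \<inter> {..t})"
    have m: "m \<in> X \<inter> {..t}"
      unfolding m_def using fin ne by (rule Max_in)
    have "X \<inter> {..t} = X \<inter> {..m}"
      using m Max_ge[OF fin[of t]] unfolding m_def by fastforce
    with le m have "m \<in> ?Q" by simp
    then have "arrival X j \<le> ereal m"
      unfolding arrival_def by (rule INF_lower)
    also have "\<dots> \<le> ereal t" using m by simp
    finally show "arrival X j \<le> ereal t" .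
  next
    assume le: "arrival X j \<le> ereal t"
    have "?Q \<noteq> {}"
    proof
      assume "?Q = {}"
      then have "arrival X j = \<infinity>" by (simp only: arrival_def image_empty Inf_empty top_ereal_def)
      with le show False by simp
    qed
    then obtain s0 where s0: "s0 \<in> ?Q" by blast
    have finQ: "finite (?Q \<inter> {..s0})" by (rule finite_subset[OF _ fin[of s0]]) auto
    define m where "m = Min (?Q \<inter> {..s0})"
    have m: "m \<in> ?Q \<inter> {..s0}"
      unfolding m_def using s0 by (intro Min_in[OF finQ]) auto
    have "m \<le> s" if "s \<in> ?Q" for s
    proof (cases "s \<le> s0")
      case True
      then show ?thesis using that Min_le[OF finQ, of s] by (simp add: m_def)
    next
      case False
      then show ?thesis using m by auto
    qed
    then have "ereal m \<le> arrival X j"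
      unfolding arrival_def by (intro INF_greatest) auto
    with le have "m \<le> t" using order_trans by fastforce
    then have "card (X \<inter> {..m}) \<le> card (X \<inter> {..t})"
      by (intro card_mono fin) auto
    with m show "j \<le> card (X \<inter> {..t})" by auto
  }
qed

text \<open>The particles \<open>(i, j)\<close> with \<open>\<bar>i\<bar> \<le> M\<close> and \<open>T\<^sub>i\<^sub>,\<^sub>j \<le> t\<close> by increasing \<open>T\<^sub>i\<^sub>,\<^sub>j\<close>.
  Ties (of probability zero for independent Poisson processes) are broken by the usual order of
  the levels, \<open>sort_key\<close> being stable.\<close>

definition timed_particles :: "(int \<Rightarrow> real set) \<Rightarrow> real \<Rightarrow> nat \<Rightarrow> particle list" where
  "timed_particles X t M =
     sort_key (\<lambda>(i, j). arrival (X i) j) (particles (\<lambda>i. card (X i \<inter> {..t})) M)"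

lemma set_timed_particles:
  assumes "\<And>i. X i \<in> point_configs"
  shows "set (timed_particles X t M) =
    {(i, j). \<bar>i\<bar> \<le> int M \<and> 1 \<le> j \<and> arrival (X i) j \<le> ereal t}"
  using assms by (auto simp: timed_particles_def set_particles arrival_le_iff)

section \<open>Random walks, Poisson variables and Poisson point processes\<close>

definition trajectory_space :: "(nat \<Rightarrow> site) measure" where
  "trajectory_space = PiM UNIV (\<lambda>_. count_space UNIV)"

definition simple_random_walk :: "'w measure \<Rightarrow> site \<Rightarrow> ('w \<Rightarrow> nat \<Rightarrow> site) \<Rightarrow> bool" where
  "simple_random_walk P x W \<longleftrightarrow>
     W \<in> P \<rightarrow>\<^sub>M trajectory_space \<and>
     (AE \<omega> in P. W \<omega> 0 = x) \<and>
     prob_space.indep_vars P (\<lambda>_. count_space UNIV) (\<lambda>t \<omega>. W \<omega> (Suc t) - W \<omega> t) UNIV \<and>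
     (\<forall>t. distr P (count_space UNIV) (\<lambda>\<omega>. W \<omega> (Suc t) - W \<omega> t) =
        measure_pmf (pmf_of_set {(1, 0), (-1, 0), (0, 1), (0, -1)}))"

definition particle_index :: "particle set" where
  "particle_index = UNIV \<times> {1..}"

definition walk_family :: "(int \<Rightarrow> nat \<Rightarrow> 'w \<Rightarrow> nat \<Rightarrow> site) \<Rightarrow> 'w \<Rightarrow> particle \<Rightarrow> nat \<Rightarrow> site" where
  "walk_family S \<omega> = (\<lambda>(i, j)\<in>particle_index. S i j \<omega>)"

definition walk_family_space :: "(particle \<Rightarrow> nat \<Rightarrow> site) measure" where
  "walk_family_space = PiM particle_index (\<lambda>_. trajectory_space)"

definition independent_walks :: "'w measure \<Rightarrow> (int \<Rightarrow> nat \<Rightarrow> 'w \<Rightarrow> nat \<Rightarrow> site) \<Rightarrow> bool" where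
  "independent_walks P S \<longleftrightarrow>
     (\<forall>i. \<forall>j\<ge>1. simple_random_walk P (0, i) (S i j)) \<and>
     prob_space.indep_vars P (\<lambda>_. trajectory_space) (\<lambda>(i, j). S i j) particle_index"

text \<open>The Poisson law is spelled out because \<open>poisson_pmf\<close> is only specified for a positive rate,
  whereas the rate \<open>0\<close> (the point mass at \<open>0\<close>) is needed here.\<close>

definition poisson_distributed :: "'w measure \<Rightarrow> real \<Rightarrow> ('w \<Rightarrow> nat) \<Rightarrow> bool" where
  "poisson_distributed P r X \<longleftrightarrow>
     X \<in> P \<rightarrow>\<^sub>M count_space UNIV \<and>
     (\<forall>k. measure P {\<omega> \<in> space P. X \<omega> = k} = exp (- r) * r ^ k / fact k)"

definition point_space :: "real set measure" where
  "point_space = sigma point_configs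
     {{X \<in> point_configs. card (X \<inter> B) = m} | B m. B \<in> sets borel \<and> bounded B}"

text \<open>Poisson point process on the half-line with intensity \<open>r\<close>, seen as a random locally finite
  set. On bounded sets the counts are cardinalities of finite sets.\<close>

definition poisson_point_process :: "'w measure \<Rightarrow> real \<Rightarrow> ('w \<Rightarrow> real set) \<Rightarrow> bool" where
  "poisson_point_process P r X \<longleftrightarrow>
     X \<in> P \<rightarrow>\<^sub>M point_space \<and>
     (\<forall>B\<in>sets borel. bounded B \<and> B \<subseteq> {0..} \<longrightarrow>
        poisson_distributed P (r * measure lborel B) (\<lambda>\<omega>. card (X \<omega> \<inter> B))) \<and>
     (\<forall>B :: nat \<Rightarrow> real set.
        (\<forall>m. B m \<in> sets borel \<and> bounded (B m) \<and> B m \<subseteq> {0..}) \<and> disjoint_family B \<longrightarrow>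
        prob_space.indep_vars P (\<lambda>_. count_space UNIV) (\<lambda>m \<omega>. card (X \<omega> \<inter> B m)) UNIV)"

text \<open>Independence of two random elements with values in possibly different types, which
  \<open>prob_space.indep_var\<close> does not allow.\<close>

definition independent_of ::
    "'w measure \<Rightarrow> 'a measure \<Rightarrow> ('w \<Rightarrow> 'a) \<Rightarrow> 'b measure \<Rightarrow> ('w \<Rightarrow> 'b) \<Rightarrow> bool" where
  "independent_of P K X L Y \<longleftrightarrow>
     X \<in> P \<rightarrow>\<^sub>M K \<and> Y \<in> P \<rightarrow>\<^sub>M L \<and>
     prob_space.indep_set P
       {X -` A \<inter> space P | A. A \<in> sets K} {Y -` B \<inter> space P | B. B \<in> sets L}"

definition iid_poisson_indep_of_walks ::
    "'w measure \<Rightarrow> (int \<Rightarrow> nat \<Rightarrow> 'w \<Rightarrow> nat \<Rightarrow> site) \<Rightarrow> real \<Rightarrow> (int \<Rightarrow> 'w \<Rightarrow> nat) \<Rightarrow> bool" where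
  "iid_poisson_indep_of_walks P S r N \<longleftrightarrow>
     (\<forall>i. poisson_distributed P r (N i)) \<and>
     prob_space.indep_vars P (\<lambda>_. count_space UNIV) N UNIV \<and>
     independent_of P (PiM UNIV (\<lambda>_. count_space UNIV)) (\<lambda>\<omega> i. N i \<omega>)
       walk_family_space (walk_family S)"

definition iid_poisson_processes_indep_of_walks ::
    "'w measure \<Rightarrow> (int \<Rightarrow> nat \<Rightarrow> 'w \<Rightarrow> nat \<Rightarrow> site) \<Rightarrow> real \<Rightarrow> (int \<Rightarrow> 'w \<Rightarrow> real set) \<Rightarrow> bool" where
  "iid_poisson_processes_indep_of_walks P S r X \<longleftrightarrow>
     (\<forall>i. poisson_point_process P r (X i)) \<and>
     prob_space.indep_vars P (\<lambda>_. point_space) X UNIV \<and>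
     independent_of P (PiM UNIV (\<lambda>_. point_space)) (\<lambda>\<omega> i. X i \<omega>)
       walk_family_space (walk_family S)"

section \<open>The three infinite aggregates\<close>

definition A_fixed :: "(int \<Rightarrow> nat \<Rightarrow> 'w \<Rightarrow> nat \<Rightarrow> site) \<Rightarrow> nat \<Rightarrow> nat \<Rightarrow> 'w \<Rightarrow> site set" where
  "A_fixed S n M \<omega> = aggregate (\<lambda>(i, j). S i j \<omega>) (particles (\<lambda>_. n) M)"

definition A_fixed_inf :: "(int \<Rightarrow> nat \<Rightarrow> 'w \<Rightarrow> nat \<Rightarrow> site) \<Rightarrow> nat \<Rightarrow> 'w \<Rightarrow> site set" where
  "A_fixed_inf S n \<omega> = (\<Union>M. A_fixed S n M \<omega>)"

definition A_star ::
    "(int \<Rightarrow> nat \<Rightarrow> 'w \<Rightarrow> nat \<Rightarrow> site) \<Rightarrow> (int \<Rightarrow> 'w \<Rightarrow> nat) \<Rightarrow> nat \<Rightarrow> 'w \<Rightarrow> site set" where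
  "A_star S N M \<omega> = aggregate (\<lambda>(i, j). S i j \<omega>) (particles (\<lambda>i. N i \<omega>) M)"

definition A_star_inf ::
    "(int \<Rightarrow> nat \<Rightarrow> 'w \<Rightarrow> nat \<Rightarrow> site) \<Rightarrow> (int \<Rightarrow> 'w \<Rightarrow> nat) \<Rightarrow> 'w \<Rightarrow> site set" where
  "A_star_inf S N \<omega> = (\<Union>M. A_star S N M \<omega>)"

definition A_dagger ::
    "(int \<Rightarrow> nat \<Rightarrow> 'w \<Rightarrow> nat \<Rightarrow> site) \<Rightarrow> (int \<Rightarrow> 'w \<Rightarrow> real set) \<Rightarrow> real \<Rightarrow> nat \<Rightarrow> 'w \<Rightarrow> site set" where
  "A_dagger S X t M \<omega> = aggregate (\<lambda>(i, j). S i j \<omega>) (timed_particles (\<lambda>i. X i \<omega>) t M)"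

definition A_dagger_inf ::
    "(int \<Rightarrow> nat \<Rightarrow> 'w \<Rightarrow> nat \<Rightarrow> site) \<Rightarrow> (int \<Rightarrow> 'w \<Rightarrow> real set) \<Rightarrow> real \<Rightarrow> 'w \<Rightarrow> site set" where
  "A_dagger_inf S X t \<omega> = (\<Union>M. A_dagger S X t M \<omega>)"

section \<open>Invariance in distribution\<close>

definition site_set_space :: "site set measure" where
  "site_set_space = sigma UNIV {{A. z \<in> A} | z. True}"

definition translation :: "int \<Rightarrow> site \<Rightarrow> site" where
  "translation k = (\<lambda>(x, y). (x, y + k))"

text \<open>The symmetry with respect to the horizontal axis at height \<open>k / 2\<close>.\<close>

definition reflection :: "int \<Rightarrow> site \<Rightarrow> site" where
  "reflection k = (\<lambda>(x, y). (x, k - y))"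

text \<open>Measurability of \<open>A\<close> is included, since \<open>distr\<close> is the law of \<open>A\<close> only under it.\<close>

definition law_invariant :: "'w measure \<Rightarrow> ('w \<Rightarrow> site set) \<Rightarrow> (site \<Rightarrow> site) \<Rightarrow> bool" where
  "law_invariant P A f \<longleftrightarrow>
     A \<in> P \<rightarrow>\<^sub>M site_set_space \<and>
     distr (distr P site_set_space A) site_set_space (\<lambda>B. f ` B) = distr P site_set_space A"

lemma measurable_image_site_set:
  assumes "bij f"
  shows "(\<lambda>B. f ` B) \<in> site_set_space \<rightarrow>\<^sub>M site_set_space"
  unfolding site_set_space_def
proof (rule measurable_measure_of)
  fix Y assume "Y \<in> {{A. z \<in> A} | z :: site. True}"
  then obtain z where Y: "Y = {A. z \<in> A}" by blast
  have "z \<in> f ` B \<longleftrightarrow> inv f z \<in> B" for B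
    using inj_image_mem_iff[OF bij_is_inj[OF assms], of "inv f z" B]
    unfolding surj_f_inv_f[OF bij_is_surj[OF assms]] .
  then have "(\<lambda>B. f ` B) -` Y = {A. inv f z \<in> A}"
    unfolding Y by blast
  moreover have "{A. inv f z \<in> A} \<in> sets (sigma UNIV {{A. z \<in> A} | z. True})"
    by (rule in_measure_of) blast+
  ultimately show "(\<lambda>B. f ` B) -` Y \<inter> space (sigma UNIV {{A. z \<in> A} | z. True})
      \<in> sets (sigma UNIV {{A. z \<in> A} | z. True})"
    by (simp only: space_measure_of_conv Int_UNIV_right)
next
  show "{{A. z \<in> A} | z :: site. True} \<subseteq> Pow UNIV"
    by blast
next
  show "(\<lambda>B. f ` B) \<in> space (sigma UNIV {{A. z \<in> A} | z. True}) \<rightarrow> UNIV"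
    by blast
qed

lemma bij_translation: "bij (translation k)"
  by (rule bij_betw_byWitness[where f' = "translation (- k)"]) (auto simp: translation_def)

lemma bij_reflection: "bij (reflection k)"
  by (rule bij_betw_byWitness[where f' = "reflection k"]) (auto simp: reflection_def)

end

theory Submission
  imports Defs
begin

text \<open>
  The law of the exit site of simple random walk satisfies the strong Markov property: the exit from
  \<open>A \<union> {a}\<close> is the exit from \<open>A\<close>, followed, if this happens at \<open>a\<close>, by an exit from \<open>A \<union> {a}\<close> started
  afresh at \<open>a\<close>. Hence two particles released from \<open>x\<close> and \<open>y\<close> may be described by independent exits
  from the same set \<open>A\<close>, plus a restart when both exit at the same site, which is symmetric in \<open>x\<close> and
  \<open>y\<close>. So the law of a finite aggregate depends only on the multiset of starting levels.

  It is also monotone in this multiset. Since a translation or reflection moves the levels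
  \<open>\<bar>i\<bar> \<le> M\<close> into \<open>\<bar>i\<bar> \<le> M + K\<close> and preserves the joint law of the numbers of particles, the probability
  that the aggregate up to level \<open>M\<close> covers \<open>f ` F\<close> is at most the probability that the one up to level
  \<open>M + K\<close> covers \<open>F\<close>. Let \<open>M\<close> tend to infinity, and argue likewise with \<open>f\<^sup>-\<^sup>1\<close>. The covering
  probabilities of finite sets determine the law of a random set. For \<open>A\<^sup>*\<close> and \<open>A\<^sup>\<dagger>\<close>, condition
  on the numbers and on the order of the particles.
\<close>

section \<open>Exit sites\<close>

text \<open>\<open>None\<close> records a walk that stays in \<open>A\<close> forever. With this
  outcome included, exit laws have total mass 1 for every \<open>A\<close>.\<close>

definition exit_site :: "site set \<Rightarrow> (nat \<Rightarrow> site) \<Rightarrow> site option" where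
  "exit_site A w = (if \<exists>t. w t \<notin> A then Some (w (LEAST t. w t \<notin> A)) else None)"

definition settle :: "site set \<Rightarrow> site option \<Rightarrow> site set" where
  "settle A z = A \<union> set_option z"

lemma send_eq_settle: "send w A = settle A (exit_site A w)"
  by (simp add: send_def settle_def exit_site_def)

lemma exit_site_eq_Some_iff:
  "exit_site A w = Some z \<longleftrightarrow> (\<exists>t. (\<forall>u<t. w u \<in> A) \<and> w t = z \<and> z \<notin> A)"
proof
  assume "exit_site A w = Some z"
  then have ex: "\<exists>t. w t \<notin> A" and z: "w (LEAST t. w t \<notin> A) = z"
    by (auto simp: exit_site_def split: if_splits)
  have "\<forall>u < LEAST t. w t \<notin> A. w u \<in> A"
    using not_less_Least by blast
  with LeastI_ex[OF ex] z show "\<exists>t. (\<forall>u<t. w u \<in> A) \<and> w t = z \<and> z \<notin> A"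
    by metis
next
  assume "\<exists>t. (\<forall>u<t. w u \<in> A) \<and> w t = z \<and> z \<notin> A"
  then obtain t where t: "\<forall>u<t. w u \<in> A" "w t = z" "z \<notin> A" by blast
  then have "(LEAST t. w t \<notin> A) = t"
    by (intro Least_equality) (auto simp: not_less[symmetric])
  with t show "exit_site A w = Some z"
    by (auto simp: exit_site_def)
qed

lemma space_trajectory_space [simp]: "space trajectory_space = UNIV"
  by (simp add: trajectory_space_def space_PiM)

lemma measurable_position [measurable]:
  "(\<lambda>w. w t) \<in> trajectory_space \<rightarrow>\<^sub>M count_space UNIV"
  unfolding trajectory_space_def by measurable

lemma measurable_exit_site [measurable]:
  "exit_site A \<in> trajectory_space \<rightarrow>\<^sub>M count_space UNIV"
proof -
  have "(\<lambda>w. LEAST t. w t \<notin> A) \<in> trajectory_space \<rightarrow>\<^sub>M count_space UNIV"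
    by measurable
  then have "(\<lambda>w. (\<lambda>t w. w t) (LEAST t. w t \<notin> A) w) \<in> trajectory_space \<rightarrow>\<^sub>M count_space UNIV"
    by (rule measurable_compose_countable[rotated]) measurable
  then show ?thesis
    unfolding exit_site_def[abs_def] by measurable
qed

section \<open>Decomposition over the values of a discrete variable\<close>

lemma emeasure_countable_split:
  fixes Z :: "'a \<Rightarrow> 'z :: countable"
  assumes [measurable]: "Z \<in> M \<rightarrow>\<^sub>M count_space UNIV"
    and Q: "\<And>z. {\<omega> \<in> space M. Q z \<omega>} \<in> sets M"
  shows "emeasure M {\<omega> \<in> space M. Q (Z \<omega>) \<omega>} =
    (\<integral>\<^sup>+z. emeasure M {\<omega> \<in> space M. Z \<omega> = z \<and> Q z \<omega>} \<partial>count_space UNIV)"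
proof -
  have [measurable]: "Measurable.pred M (Q z)" for z
    using Q[of z] by (simp add: pred_def)
  have "{\<omega> \<in> space M. Q (Z \<omega>) \<omega>} = (\<Union>z. {\<omega> \<in> space M. Z \<omega> = z \<and> Q z \<omega>})"
    by auto
  then show ?thesis
    by (simp only:) (intro emeasure_UN_countable; auto simp: disjoint_family_on_def)
qed

text \<open>Conditioning on \<open>Z\<close>: on \<open>Z = z\<close> the event is
  \<open>Q z\<close>, whose probability is unaffected by the condition, so summing over
  \<open>z\<close> gives a mixture. It serves for the exit site of the first particle and for the
  random order of the particles.\<close>

lemma emeasure_independent_mixture:
  fixes Z :: "'a \<Rightarrow> 'z :: countable" and R :: "'z \<Rightarrow> 'b pmf"
  assumes Z [measurable]: "Z \<in> M \<rightarrow>\<^sub>M count_space UNIV"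
    and law_Z: "\<And>z. emeasure M {\<omega> \<in> space M. Z \<omega> = z} = ennreal (pmf p z)"
    and Q: "\<And>z. {\<omega> \<in> space M. Q z \<omega>} \<in> sets M"
    and indep: "\<And>z. emeasure M {\<omega> \<in> space M. Z \<omega> = z \<and> Q z \<omega>} =
      emeasure M {\<omega> \<in> space M. Z \<omega> = z} * emeasure M {\<omega> \<in> space M. Q z \<omega>}"
    and law_Q: "\<And>z. emeasure M {\<omega> \<in> space M. Q z \<omega>} = emeasure (measure_pmf (R z)) B"
  shows "emeasure M {\<omega> \<in> space M. Q (Z \<omega>) \<omega>} = emeasure (measure_pmf (bind_pmf p R)) B"
  by (subst emeasure_countable_split[OF Z Q])
    (simp add: indep law_Z law_Q nn_integral_measure_pmf)

lemma (in prob_space) pmf_embed_pmf_discrete: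
  fixes Z :: "'a \<Rightarrow> 'z :: countable"
  assumes Z: "Z \<in> M \<rightarrow>\<^sub>M count_space UNIV"
  shows "pmf (embed_pmf (\<lambda>z. prob {\<omega> \<in> space M. Z \<omega> = z})) z = prob {\<omega> \<in> space M. Z \<omega> = z}"
proof (rule pmf_embed_pmf)
  show "(\<integral>\<^sup>+z. ennreal (prob {\<omega> \<in> space M. Z \<omega> = z}) \<partial>count_space UNIV) = 1"
    using emeasure_countable_split[OF Z, of "\<lambda>_ _. True"]
    by (simp add: emeasure_space_1 emeasure_eq_measure[symmetric])
qed simp

section \<open>The exit law of simple random walk\<close>

definition walk_step :: "site pmf" where
  "walk_step = pmf_of_set {(1, 0), (-1, 0), (0, 1), (0, -1)}"

lemma finite_set_walk_step [simp]: "finite (set_pmf walk_step)"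
  by (simp add: walk_step_def)

text \<open>Consuming the first step suits first-step analysis; \<open>walk_path_Suc\<close> adds
  the last step instead, for measurability and for the comparison with a given walk.\<close>

primrec walk_path :: "site \<Rightarrow> site stream \<Rightarrow> nat \<Rightarrow> site" where
  "walk_path x s 0 = x"
| "walk_path x s (Suc t) = walk_path (x + shd s) (stl s) t"

abbreviation steps :: "site stream measure" where
  "steps \<equiv> stream_space (measure_pmf walk_step)"

interpretation steps: prob_space steps
  by (rule prob_space.prob_space_stream_space) unfold_locales

lemma space_steps [simp]: "space steps = UNIV"
  by (simp add: space_stream_space)

lemma walk_path_Suc: "walk_path x s (Suc t) = walk_path x s t + s !! t"
  by (induction t arbitrary: x s) auto

lemma measurable_walk_path_at [measurable]: "(\<lambda>s. walk_path x s t) \<in> steps \<rightarrow>\<^sub>M count_space UNIV"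
proof (induction t)
  case (Suc t)
  have [measurable]: "(\<lambda>s. s !! t) \<in> steps \<rightarrow>\<^sub>M count_space UNIV"
    using measurable_snth[of t "measure_pmf walk_step"]
    by (simp cong: measurable_cong_sets)
  show ?case
    unfolding walk_path_Suc
    by (rule measurable_compose_countable[OF _ Suc, of "\<lambda>y s. y + s !! t"]) measurable
qed simp

lemma measurable_walk_path [measurable]: "walk_path x \<in> steps \<rightarrow>\<^sub>M trajectory_space"
  unfolding trajectory_space_def by (rule measurable_PiM_single') auto

definition exit_pmf :: "site set \<Rightarrow> site \<Rightarrow> site option pmf" where
  "exit_pmf A x = embed_pmf (\<lambda>z. steps.prob {s. exit_site A (walk_path x s) = z})"

lemma pmf_exit_pmf: "pmf (exit_pmf A x) z = steps.prob {s. exit_site A (walk_path x s) = z}"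
  using steps.pmf_embed_pmf_discrete[of "\<lambda>s. exit_site A (walk_path x s)" z]
  by (simp add: exit_pmf_def)

section \<open>Exit probabilities at a given time\<close>

definition exits_at :: "site set \<Rightarrow> (nat \<Rightarrow> site) \<Rightarrow> nat \<Rightarrow> site \<Rightarrow> bool" where
  "exits_at A w t z \<longleftrightarrow> (\<forall>u<t. w u \<in> A) \<and> w t = z \<and> z \<notin> A"

text \<open>Fixing the exit time allows induction on \<open>t\<close>;
  \<open>exit_prob_at_sums\<close> then recovers the exit law.\<close>

definition exit_prob_at :: "site set \<Rightarrow> site \<Rightarrow> nat \<Rightarrow> site \<Rightarrow> real" where
  "exit_prob_at A x t z = steps.prob {s. exits_at A (walk_path x s) t z}"

lemma measurable_exits_at [measurable]: "Measurable.pred steps (\<lambda>s. exits_at A (walk_path x s) t z)"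
  unfolding exits_at_def by measurable

lemma exits_at_Suc:
  "exits_at A (walk_path x (d ## s)) (Suc t) z \<longleftrightarrow> x \<in> A \<and> exits_at A (walk_path (x + d) s) t z"
  by (auto simp: exits_at_def All_less_Suc2)

lemma exit_prob_at_0: "exit_prob_at A x 0 z = of_bool (x = z \<and> z \<notin> A)"
  using steps.prob_space by (simp add: exit_prob_at_def exits_at_def)

lemma exit_prob_at_nonneg [simp]: "0 \<le> exit_prob_at A x t z"
  by (simp add: exit_prob_at_def)

text \<open>First-step analysis: the stream measure splits into its head \<open>d\<close> and an
  independent tail with the same law.\<close>

lemma exit_prob_at_Suc:
  "exit_prob_at A x (Suc t) z =
     (if x \<in> A then measure_pmf.expectation walk_step (\<lambda>d. exit_prob_at A (x + d) t z) else 0)"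
proof -
  have "ennreal (exit_prob_at A x (Suc t) z) =
    (\<integral>\<^sup>+d. ennreal (steps.prob {s. exits_at A (walk_path x (d ## s)) (Suc t) z}) \<partial>measure_pmf walk_step)"
    using prob_space.prob_stream_space[OF prob_space_measure_pmf,
        of walk_step "\<lambda>s. exits_at A (walk_path x s) (Suc t) z"]
      measurable_exits_at[of A x "Suc t" z]
    by (simp add: exit_prob_at_def pred_def del: walk_path.simps)
  also have "\<dots> = (\<integral>\<^sup>+d. ennreal (if x \<in> A then exit_prob_at A (x + d) t z else 0) \<partial>measure_pmf walk_step)"
    by (simp only: exits_at_Suc exit_prob_at_def)
       (auto intro!: nn_integral_cong)
  also have "\<dots> = ennreal (measure_pmf.expectation walk_step (\<lambda>d. if x \<in> A then exit_prob_at A (x + d) t z else 0))"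
    by (rule nn_integral_eq_integral) (auto intro: integrable_measure_pmf_finite)
  finally show ?thesis
    by (simp split: if_splits add: integral_nonneg_AE)
qed

lemma exit_prob_at_sums: "(\<lambda>t. exit_prob_at A x t z) sums pmf (exit_pmf A x) (Some z)"
proof -
  have disj: "disjoint_family (\<lambda>t. {s. exits_at A (walk_path x s) t z})"
    unfolding disjoint_family_on_def exits_at_def by (auto, metis linorder_neqE_nat)
  have "(\<Union>t. {s. exits_at A (walk_path x s) t z}) = {s. exit_site A (walk_path x s) = Some z}"
    by (auto simp: exit_site_eq_Some_iff exits_at_def)
  then show ?thesis
    using steps.finite_measure_UNION[OF _ disj] measurable_exits_at[of A x _ z]
    by (auto simp: exit_prob_at_def pmf_exit_pmf pred_def)
qed

text \<open>Either the walk already leaves \<open>A\<close> at \<open>b\<close>, or it leaves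
  \<open>A\<close> at \<open>a\<close> at some time \<open>s\<close> and starts afresh from
  \<open>a\<close> with \<open>t - s\<close> steps left.\<close>

lemma exit_prob_at_insert:
  assumes "a \<notin> A" "b \<notin> insert a A"
  shows "exit_prob_at (insert a A) y t b =
    exit_prob_at A y t b + (\<Sum>s\<le>t. exit_prob_at A y s a * exit_prob_at (insert a A) a (t - s) b)"
proof (induction t arbitrary: y)
  case 0
  show ?case using assms by (auto simp: exit_prob_at_0)
next
  case (Suc t)
  \<comment> \<open>The term \<open>s = 0\<close> is split off: it is nonzero only for a walk
    started at \<open>a\<close>.\<close>
  have *: "(\<Sum>s\<le>Suc t. exit_prob_at A y s a * exit_prob_at (insert a A) a (Suc t - s) b) =
    of_bool (y = a) * exit_prob_at (insert a A) a (Suc t) b +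
    (\<Sum>s\<le>t. exit_prob_at A y (Suc s) a * exit_prob_at (insert a A) a (t - s) b)"
    using assms by (subst sum.atMost_Suc_shift) (simp add: exit_prob_at_0)
  \<comment> \<open>Inside \<open>A\<close> every term is averaged over the first step. Outside
    \<open>A\<close> a walk exits at time 0, so at \<open>a\<close> only the \<open>s = 0\<close>
    term survives, and elsewhere everything vanishes.\<close>
  consider "y \<in> A" | "y = a" | "y \<notin> insert a A" by blast
  then show ?case
  proof cases
    case 1
    have "exit_prob_at (insert a A) y (Suc t) b =
      measure_pmf.expectation walk_step (\<lambda>d. exit_prob_at A (y + d) t b +
        (\<Sum>s\<le>t. exit_prob_at A (y + d) s a * exit_prob_at (insert a A) a (t - s) b))"
      using 1 by (simp add: exit_prob_at_Suc Suc.IH)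
    also have "\<dots> = exit_prob_at A y (Suc t) b +
      (\<Sum>s\<le>t. exit_prob_at A y (Suc s) a * exit_prob_at (insert a A) a (t - s) b)"
      using 1 by (simp add: exit_prob_at_Suc Bochner_Integration.integral_add
          Bochner_Integration.integral_sum integrable_measure_pmf_finite)
    finally show ?thesis
      using 1 assms unfolding * by auto
  next
    case 2
    then show ?thesis using assms unfolding * by (simp add: exit_prob_at_Suc)
  next
    case 3
    then show ?thesis using assms unfolding * by (simp add: exit_prob_at_Suc)
  qed
qed

text \<open>The mass at \<open>None\<close> is 1 minus the sum of the masses at
  \<open>Some b\<close>, so walks that never exit need no computation.\<close>

lemma pmf_option_eqI:
  assumes "\<And>b. pmf p (Some b) = pmf q (Some b)"
  shows "p = q"
proof (rule pmf_eqI)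
  fix z
  have *: "measure_pmf.prob r (range Some) = (\<Sum>\<^sub>ab. pmf r (Some b))" for r :: "'a option pmf"
    by (subst measure_pmf_conv_infsetsum) (simp add: infsetsum_reindex)
  have "pmf r None = 1 - measure_pmf.prob r (range Some)" for r :: "'a option pmf"
    using measure_pmf.finite_measure_Union[of "{None}" r "range Some"]
    by (simp add: measure_pmf_single flip: UNIV_option_conv)
  with assms show "pmf p z = pmf q z"
    by (cases z) (simp_all add: *)
qed

text \<open>The strong Markov property at the exit time from \<open>A\<close>; the exit probabilities at a given
  time satisfy it as a convolution identity.\<close>

lemma exit_pmf_insert:
  assumes "a \<notin> A"
  shows "exit_pmf (insert a A) y =
    bind_pmf (exit_pmf A y) (\<lambda>z. if z = Some a then exit_pmf (insert a A) a else return_pmf z)"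
proof (rule pmf_option_eqI)
  fix b
  let ?p = "exit_pmf A y" and ?q = "exit_pmf (insert a A) a"
  have outside: "pmf (exit_pmf B x) (Some c) = 0" if "c \<in> B" for B x c
    using that by (auto simp: pmf_exit_pmf exit_site_eq_Some_iff)
  \<comment> \<open>The integrand depends on \<open>z\<close> only through \<open>z = Some a\<close>
    and \<open>z = Some b\<close>; the factor \<open>of_bool (b \<noteq> a)\<close> avoids counting
    the restart value twice when these coincide.\<close>
  have "pmf (bind_pmf ?p (\<lambda>z. if z = Some a then ?q else return_pmf z)) (Some b) =
    measure_pmf.expectation ?p (\<lambda>z. pmf ?q (Some b) * indicator {Some a} z + of_bool (b \<noteq> a) * indicator {Some b} z)"
    unfolding pmf_bind by (intro Bochner_Integration.integral_cong) (auto simp: indicator_def)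
  also have "\<dots> = pmf ?q (Some b) * pmf ?p (Some a) + of_bool (b \<noteq> a) * pmf ?p (Some b)"
    by (subst Bochner_Integration.integral_add)
      (auto simp: measure_pmf_single intro!: measure_pmf.integrable_const_bound[where B = 1])
  also have "\<dots> = pmf (exit_pmf (insert a A) y) (Some b)"
  proof (cases "b \<in> insert a A")
    case True
    then show ?thesis by (auto simp: outside)
  next
    case False
    let ?f = "\<lambda>t. exit_prob_at A y t a" and ?g = "\<lambda>t. exit_prob_at (insert a A) a t b"
    \<comment> \<open>Summed over \<open>t\<close>, the convolution factors: the probability of
      reaching \<open>a\<close> times that of exiting at \<open>b\<close> from there.\<close>
    have "(\<lambda>t. \<Sum>s\<le>t. ?f s * ?g (t - s)) sums ((\<Sum>t. ?f t) * (\<Sum>t. ?g t))"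
      by (intro Cauchy_product_sums) (simp_all add: sums_summable[OF exit_prob_at_sums])
    then have "(\<lambda>t. exit_prob_at A y t b + (\<Sum>s\<le>t. ?f s * ?g (t - s))) sums
        (pmf ?p (Some b) + pmf ?p (Some a) * pmf ?q (Some b))"
      by (intro sums_add exit_prob_at_sums) (simp add: sums_unique[OF exit_prob_at_sums, symmetric])
    with False exit_prob_at_insert[OF assms False, of y] show ?thesis
      using sums_unique2[OF exit_prob_at_sums[of "insert a A" y b]] by (simp add: mult.commute)
  qed
  finally show "pmf (exit_pmf (insert a A) y) (Some b) =
      pmf (bind_pmf ?p (\<lambda>z. if z = Some a then ?q else return_pmf z)) (Some b)" ..
qed

section \<open>The exit law of an arbitrary simple random walk\<close>

lemma (in prob_space) distr_indep_vars:
  assumes "indep_vars (\<lambda>_. N) X UNIV" and "\<And>i. distr M N (X i) = D"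
  shows "distr M (PiM UNIV (\<lambda>_. N)) (\<lambda>\<omega> i. X i \<omega>) = PiM UNIV (\<lambda>_. D)"
proof -
  have "random_variable N (X i)" for i
    using assms(1) by (simp add: indep_vars_def)
  then show ?thesis
    using indep_vars_iff_distr_eq_PiM'[where I = UNIV and M' = "\<lambda>_. N" and X = X] assms by (simp add: restrict_def)
qed

text \<open>The increments of \<open>W\<close>, read as the stream \<open>V\<close>, have law
  \<open>steps\<close>, and almost surely \<open>W\<close> is the path that they drive from
  \<open>x\<close>.\<close>

lemma (in prob_space) prob_exit_site:
  assumes "simple_random_walk M x W"
  shows "prob {\<omega> \<in> space M. exit_site A (W \<omega>) = z} = pmf (exit_pmf A x) z"
proof -
  define V where "V = (\<lambda>\<omega>. to_stream (\<lambda>t. W \<omega> (Suc t) - W \<omega> t))"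
  have W [measurable]: "W \<in> M \<rightarrow>\<^sub>M trajectory_space" and W0: "AE \<omega> in M. W \<omega> 0 = x"
    and indep: "indep_vars (\<lambda>_. count_space UNIV) (\<lambda>t \<omega>. W \<omega> (Suc t) - W \<omega> t) UNIV"
    and law: "\<And>t. distr M (count_space UNIV) (\<lambda>\<omega>. W \<omega> (Suc t) - W \<omega> t) = measure_pmf walk_step"
    using assms by (auto simp: simple_random_walk_def walk_step_def)
  have D: "distr M (PiM UNIV (\<lambda>_. count_space UNIV)) (\<lambda>\<omega> t. W \<omega> (Suc t) - W \<omega> t) =
      PiM UNIV (\<lambda>_. measure_pmf walk_step)"
    by (rule distr_indep_vars[OF indep law])
  have incr: "(\<lambda>\<omega> t. W \<omega> (Suc t) - W \<omega> t) \<in> M \<rightarrow>\<^sub>M PiM UNIV (\<lambda>_. count_space UNIV)"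
    using indep by (intro measurable_PiM_single') (auto simp: indep_vars_def)
  have to_stream: "to_stream \<in> PiM UNIV (\<lambda>_. count_space UNIV) \<rightarrow>\<^sub>M steps"
    using measurable_to_stream[of "measure_pmf walk_step"]
    by (simp cong: measurable_cong_sets sets_PiM_cong)
  have V [measurable]: "V \<in> M \<rightarrow>\<^sub>M steps"
    unfolding V_def by (rule measurable_compose[OF incr to_stream])
  have "steps = distr (distr M (PiM UNIV (\<lambda>_. count_space UNIV)) (\<lambda>\<omega> t. W \<omega> (Suc t) - W \<omega> t)) steps to_stream"
    unfolding D by (rule stream_space_eq_distr)
  also have "\<dots> = distr M steps V"
    by (subst distr_distr[OF to_stream incr]) (simp add: comp_def V_def)
  finally have law_V: "steps = distr M steps V" .
  have "AE \<omega> in M. W \<omega> = walk_path x (V \<omega>)"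
    using W0
  proof eventually_elim
    case (elim \<omega>)
    have "W \<omega> t = walk_path x (V \<omega>) t" for t
      by (induction t) (simp_all add: elim walk_path_Suc V_def to_stream_def del: walk_path.simps(2))
    then show ?case by blast
  qed
  then have "prob {\<omega> \<in> space M. exit_site A (W \<omega>) = z} = prob {\<omega> \<in> space M. exit_site A (walk_path x (V \<omega>)) = z}"
    by (intro finite_measure_eq_AE) (auto elim: AE_mp)
  also have "\<dots> = measure (distr M steps V) {s. exit_site A (walk_path x s) = z}"
  proof (subst measure_distr)
    show "{s. exit_site A (walk_path x s) = z} \<in> sets steps"
      using measurable_sets[OF measurable_compose[OF measurable_walk_path[of x] measurable_exit_site[of A]], of "{z}"]
      by (simp add: vimage_def)
  qed (auto intro!: arg_cong[where f = prob])
  finally show ?thesis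
    by (simp add: pmf_exit_pmf flip: law_V)
qed

section \<open>The Abelian property\<close>

definition settle_pmf :: "site \<Rightarrow> site set \<Rightarrow> site set pmf" where
  "settle_pmf x A = map_pmf (settle A) (exit_pmf A x)"

text \<open>The fold acts on laws rather than sets, so that sending a particle is an operator;
  commutation of these operators gives invariance under reordering.\<close>

definition aggregate_pmf :: "site list \<Rightarrow> site set pmf \<Rightarrow> site set pmf" where
  "aggregate_pmf xs p = fold (\<lambda>x p. bind_pmf p (settle_pmf x)) xs p"

lemma settle_commute: "settle (settle A z) z' = settle (settle A z') z"
  by (auto simp: settle_def)

text \<open>\<open>exit_pmf_insert\<close> together with the case \<open>None\<close>, where
  \<open>A\<close> is unchanged and the right side reduces to the exit law itself. That
  \<open>z\<close> lies in the support ensures that an exit site \<open>a\<close> is outside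
  \<open>A\<close>.\<close>

lemma exit_pmf_settle:
  assumes "z \<in> set_pmf (exit_pmf A x)"
  shows "exit_pmf (settle A z) y =
    bind_pmf (exit_pmf A y) (\<lambda>z'. if z' = z then (case z of None \<Rightarrow> return_pmf None | Some a \<Rightarrow> exit_pmf (insert a A) a)
      else return_pmf z')"
proof (cases z)
  case None
  then show ?thesis
    by (auto simp: settle_def bind_return_pmf' intro!: trans[OF bind_return_pmf'[symmetric] bind_pmf_cong])
next
  case (Some a)
  have "a \<notin> A"
    using assms unfolding Some by (auto simp: set_pmf_iff pmf_exit_pmf exit_site_eq_Some_iff)
  then show ?thesis
    using exit_pmf_insert[of a A y] unfolding Some by (simp add: settle_def cong: if_cong)
qed

lemma settle_pmf_commute:
  "bind_pmf (settle_pmf x A) (settle_pmf y) = bind_pmf (settle_pmf y A) (settle_pmf x)"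
proof -
  \<comment> \<open>\<open>R z z'\<close> is the law of the final set when two independent walks
    leave the same \<open>A\<close> at \<open>z\<close> and \<open>z'\<close>: different exits are
    both added, equal ones cause a restart there. Its symmetry lets the two draws be
    exchanged.\<close>
  define R where "R z z' = (if z' = z then map_pmf (settle (settle A z))
      (case z of None \<Rightarrow> return_pmf None | Some a \<Rightarrow> exit_pmf (insert a A) a)
    else return_pmf (settle (settle A z) z'))" for z z'
  have "bind_pmf (settle_pmf x A) (settle_pmf y) =
      bind_pmf (exit_pmf A x) (\<lambda>z. bind_pmf (exit_pmf A y) (R z))" for x y
    unfolding settle_pmf_def bind_map_pmf
  proof (intro bind_pmf_cong refl)
    fix z assume "z \<in> set_pmf (exit_pmf A x)"
    then show "map_pmf (settle (settle A z)) (exit_pmf (settle A z) y) = bind_pmf (exit_pmf A y) (R z)"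
      unfolding R_def by (auto simp: exit_pmf_settle map_bind_pmf intro!: bind_pmf_cong)
  qed
  moreover have "R z z' = R z' z" for z z'
    by (auto simp: R_def settle_commute)
  ultimately show ?thesis
    by (simp add: bind_commute_pmf[of "exit_pmf A x"])
qed

lemma aggregate_pmf_cong_mset:
  assumes "mset xs = mset ys"
  shows "aggregate_pmf xs = aggregate_pmf ys"
  unfolding aggregate_pmf_def
  by (intro ext fun_cong[OF fold_multiset_equiv[OF _ assms]])
    (auto simp: fun_eq_iff bind_assoc_pmf settle_pmf_commute)

lemma aggregate_pmf_simps [simp]:
  "aggregate_pmf [] p = p"
  "aggregate_pmf (x # xs) p = aggregate_pmf xs (bind_pmf p (settle_pmf x))"
  "aggregate_pmf (xs @ ys) p = aggregate_pmf ys (aggregate_pmf xs p)"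
  by (simp_all add: aggregate_pmf_def)

lemma aggregate_pmf_bind:
  "aggregate_pmf xs (bind_pmf p f) = bind_pmf p (\<lambda>A. aggregate_pmf xs (f A))"
  by (induction xs arbitrary: f) (simp_all add: bind_assoc_pmf)

text \<open>Settling only enlarges a set, so a set that covers \<open>F\<close> keeps covering
  it.\<close>

lemma aggregate_pmf_mono:
  "measure_pmf.prob p {A. F \<subseteq> A} \<le> measure_pmf.prob (aggregate_pmf xs p) {A. F \<subseteq> A}"
proof (induction xs arbitrary: p)
  case (Cons x xs)
  have "emeasure p {A. F \<subseteq> A} = (\<integral>\<^sup>+A. indicator {A. F \<subseteq> A} A \<partial>p)"
    by simp
  also have "\<dots> \<le> (\<integral>\<^sup>+A. emeasure (settle_pmf x A) {A. F \<subseteq> A} \<partial>p)"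
  proof (rule nn_integral_mono)
    fix A
    have "emeasure (settle_pmf x A) {A. F \<subseteq> A} = 1" if "F \<subseteq> A"
      using that by (subst measure_pmf.emeasure_eq_1_AE) (auto simp: settle_pmf_def settle_def AE_measure_pmf_iff)
    then show "indicator {A. F \<subseteq> A} A \<le> emeasure (settle_pmf x A) {A. F \<subseteq> A}"
      by (simp add: indicator_def)
  qed
  also have "\<dots> = emeasure (bind_pmf p (settle_pmf x)) {A. F \<subseteq> A}"
    by simp
  finally have "measure_pmf.prob p {A. F \<subseteq> A} \<le> measure_pmf.prob (bind_pmf p (settle_pmf x)) {A. F \<subseteq> A}"
    by (simp only: measure_pmf.emeasure_eq_measure ennreal_le_iff measure_nonneg)
  then show ?case
    using Cons[of "bind_pmf p (settle_pmf x)"] by simp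
qed simp

definition cover_prob :: "site set \<Rightarrow> site list \<Rightarrow> real" where
  "cover_prob F xs = measure_pmf.prob (aggregate_pmf xs (return_pmf {})) {A. F \<subseteq> A}"

text \<open>By reordering, the surplus starting points can be sent last, where they can only help to
  cover \<open>F\<close>.\<close>

lemma cover_prob_mono:
  assumes "mset xs \<subseteq># mset ys"
  shows "cover_prob F xs \<le> cover_prob F ys"
proof -
  obtain zs where zs: "mset zs = mset ys - mset xs"
    using ex_mset by blast
  with assms have "mset (xs @ zs) = mset ys"
    by simp
  then show ?thesis
    using aggregate_pmf_mono[of "aggregate_pmf xs (return_pmf {})" F zs]
    by (simp add: cover_prob_def flip: aggregate_pmf_cong_mset[of "xs @ zs" ys])
qed

section \<open>Lattice symmetries\<close>

text \<open>\<open>L\<close> is the linear part of \<open>f\<close>: a step \<open>d\<close> of the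
  walk becomes the step \<open>L d\<close> of its image.\<close>

definition lattice_symmetry :: "(site \<Rightarrow> site) \<Rightarrow> bool" where
  "lattice_symmetry f \<longleftrightarrow> bij f \<and>
    (\<exists>L. (\<forall>x d. f (x + d) = f x + L d) \<and> map_pmf L walk_step = walk_step)"

lemma exit_pmf_symmetry:
  assumes f: "lattice_symmetry f"
  shows "exit_pmf (f ` A) (f x) = map_pmf (map_option f) (exit_pmf A x)"
proof -
  obtain L where "bij f" and L: "\<And>x d. f (x + d) = f x + L d" "map_pmf L walk_step = walk_step"
    using f by (auto simp: lattice_symmetry_def)
  then have inj: "inj f" and surj: "surj f"
    by (auto simp: bij_def)
  have at: "exit_prob_at (f ` A) (f x) t (f z) = exit_prob_at A x t z" for t x z
  proof (induction t arbitrary: x)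
    case 0
    then show ?case by (simp add: exit_prob_at_0 inj_image_mem_iff[OF inj] inj_eq[OF inj])
  next
    case (Suc t)
    \<comment> \<open>The step law is replaced by its image under \<open>L\<close>; then
      \<open>f x + L d = f (x + d)\<close> and the induction hypothesis applies.\<close>
    have "measure_pmf.expectation walk_step (\<lambda>d. exit_prob_at (f ` A) (f x + d) t (f z)) =
        measure_pmf.expectation (map_pmf L walk_step) (\<lambda>d. exit_prob_at (f ` A) (f x + d) t (f z))"
      by (simp only: L)
    also have "\<dots> = measure_pmf.expectation walk_step (\<lambda>d. exit_prob_at A (x + d) t z)"
      by (simp add: Suc.IH flip: L(1))
    finally show ?case
      by (simp add: exit_prob_at_Suc inj_image_mem_iff[OF inj])
  qed
  show ?thesis
  proof (rule pmf_option_eqI)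
    fix b
    obtain z where b: "b = f z" using surj by blast
    have "pmf (exit_pmf (f ` A) (f x)) (Some b) = pmf (exit_pmf A x) (Some z)"
      using exit_prob_at_sums[of "f ` A" "f x" b] exit_prob_at_sums[of A x z]
      by (simp add: b at sums_unique2)
    also have "\<dots> = pmf (map_pmf (map_option f) (exit_pmf A x)) (Some b)"
      using pmf_map_inj'[OF option.inj_map[OF inj], of "exit_pmf A x" "Some z"] by (simp add: b)
    finally show "pmf (exit_pmf (f ` A) (f x)) (Some b) = pmf (map_pmf (map_option f) (exit_pmf A x)) (Some b)" .
  qed
qed

lemma aggregate_pmf_symmetry:
  assumes "lattice_symmetry f"
  shows "aggregate_pmf (map f xs) (map_pmf ((`) f) p) = map_pmf ((`) f) (aggregate_pmf xs p)"
proof (induction xs arbitrary: p)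
  case (Cons x xs)
  have "settle_pmf (f x) (f ` A) = map_pmf ((`) f) (settle_pmf x A)" for A
    by (auto simp: settle_pmf_def exit_pmf_symmetry[OF assms] map_pmf_comp settle_def option.set_map
        image_Un intro!: map_pmf_cong)
  then have "bind_pmf (map_pmf ((`) f) p) (settle_pmf (f x)) = map_pmf ((`) f) (bind_pmf p (settle_pmf x))"
    by (simp add: bind_map_pmf map_bind_pmf)
  then show ?case
    by (simp add: Cons)
qed simp

lemma cover_prob_symmetry:
  assumes "lattice_symmetry f"
  shows "cover_prob (f ` F) (map f xs) = cover_prob F xs"
proof -
  have "inj f" using assms by (auto simp: lattice_symmetry_def bij_def)
  then have "(`) f -` {A. f ` F \<subseteq> A} = {A. F \<subseteq> A}"
    by (auto simp: inj_image_subset_iff)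
  then show ?thesis
    using aggregate_pmf_symmetry[OF assms, of xs "return_pmf {}"] by (simp add: cover_prob_def)
qed

section \<open>The aggregate of finitely many independent walks\<close>

text \<open>Site sets are uncountably many, but the outcome is determined by finitely many exits
  from a countable type. Fixing the first exit reduces to a shorter list with another deterministic
  initial set.\<close>

lemma measurable_fold_send:
  assumes "\<And>p. p \<in> set ps \<Longrightarrow> W p \<in> M \<rightarrow>\<^sub>M trajectory_space"
  shows "(\<lambda>\<omega>. fold (\<lambda>p. send (W p \<omega>)) ps A) \<in> M \<rightarrow>\<^sub>M count_space UNIV"
  using assms
proof (induction ps arbitrary: A)
  case (Cons p ps)
  have "(\<lambda>\<omega>. exit_site A (W p \<omega>)) \<in> M \<rightarrow>\<^sub>M count_space UNIV"
    using Cons.prems[of p] by (intro measurable_compose[OF _ measurable_exit_site]) auto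
  then have "(\<lambda>\<omega>. (\<lambda>z \<omega>. fold (\<lambda>p. send (W p \<omega>)) ps (settle A z)) (exit_site A (W p \<omega>)) \<omega>) \<in> M \<rightarrow>\<^sub>M count_space UNIV"
    by (rule measurable_compose_countable[rotated]) (use Cons in auto)
  then show ?case
    by (simp add: send_eq_settle[where A = A])
qed simp

text \<open>The first particle is peeled off: its exit site involves only \<open>W p\<close>, the
  rest of the fold only the other walks. As \<open>ps\<close> is distinct, these are independent
  once the set after the first exit is fixed.\<close>

lemma (in prob_space) emeasure_fold_send:
  assumes indep: "indep_vars (\<lambda>_. trajectory_space) W I"
    and walk: "\<And>p. p \<in> I \<Longrightarrow> simple_random_walk M (x p) (W p)"
    and "distinct ps" "set ps \<subseteq> I"
  shows "emeasure M {\<omega> \<in> space M. fold (\<lambda>p. send (W p \<omega>)) ps A \<in> B} =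
    emeasure (aggregate_pmf (map x ps) (return_pmf A)) B"
  using assms(3,4)
proof (induction ps arbitrary: A)
  case Nil
  then show ?case by (simp add: emeasure_space_1 indicator_def)
next
  case (Cons p ps)
  have W: "W q \<in> M \<rightarrow>\<^sub>M trajectory_space" if "q \<in> I" for q
    using walk[OF that] by (simp add: simple_random_walk_def)
  have Z: "(\<lambda>\<omega>. exit_site A (W p \<omega>)) \<in> M \<rightarrow>\<^sub>M count_space UNIV"
    using W[of p] Cons.prems by (intro measurable_compose[OF _ measurable_exit_site]) auto
  have fold_meas: "(\<lambda>\<omega>. fold (\<lambda>p. send (W p \<omega>)) ps C) \<in> M \<rightarrow>\<^sub>M count_space UNIV" for C
    using W Cons.prems by (intro measurable_fold_send) auto
  have ind: "indep_var (PiM {p} (\<lambda>_. trajectory_space)) (\<lambda>\<omega>. restrict (\<lambda>q. W q \<omega>) {p})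
      (PiM (set ps) (\<lambda>_. trajectory_space)) (\<lambda>\<omega>. restrict (\<lambda>q. W q \<omega>) (set ps))"
    using Cons.prems by (intro indep_var_restrict[OF indep]) auto
  have "emeasure M {\<omega> \<in> space M. exit_site A (W p \<omega>) = z \<and> fold (\<lambda>p. send (W p \<omega>)) ps C \<in> B} =
      emeasure M {\<omega> \<in> space M. exit_site A (W p \<omega>) = z} *
      emeasure M {\<omega> \<in> space M. fold (\<lambda>p. send (W p \<omega>)) ps C \<in> B}" for z C
  proof -
    let ?f = "\<lambda>h. exit_site A (h p) = z" and ?g = "\<lambda>h. fold (\<lambda>q. send (h q)) ps C \<in> B"
    have [measurable]: "(\<lambda>h. exit_site A (h p)) \<in> PiM {p} (\<lambda>_. trajectory_space) \<rightarrow>\<^sub>M count_space UNIV"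
      by (intro measurable_compose[OF _ measurable_exit_site]) measurable
    have [measurable]: "Measurable.pred (PiM (set ps) (\<lambda>_. trajectory_space)) ?g"
      by (rule pred_sets2[OF _ measurable_fold_send[where W = "\<lambda>q h. h q"]]) measurable
    have "indep_var (count_space UNIV) (?f \<circ> (\<lambda>\<omega>. restrict (\<lambda>q. W q \<omega>) {p}))
      (count_space UNIV) (?g \<circ> (\<lambda>\<omega>. restrict (\<lambda>q. W q \<omega>) (set ps)))"
      by (rule indep_var_compose[OF ind]) measurable
    moreover have "fold (\<lambda>q. send (restrict (\<lambda>q. W q \<omega>) (set ps) q)) ps C = fold (\<lambda>q. send (W q \<omega>)) ps C" for \<omega>
      by (intro fold_cong) auto
    ultimately have "indep_var (count_space UNIV) (\<lambda>\<omega>. exit_site A (W p \<omega>) = z)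
      (count_space UNIV) (\<lambda>\<omega>. fold (\<lambda>q. send (W q \<omega>)) ps C \<in> B)"
      by (simp add: comp_def)
    from indep_varD[OF this, of "{True}" "{True}"] show ?thesis
      by (simp add: emeasure_eq_measure ennreal_mult vimage_def Int_def conj_commute)
  qed
  then have "emeasure M {\<omega> \<in> space M. fold (\<lambda>p. send (W p \<omega>)) ps (settle A (exit_site A (W p \<omega>))) \<in> B} =
      emeasure (bind_pmf (exit_pmf A (x p)) (\<lambda>z. aggregate_pmf (map x ps) (return_pmf (settle A z)))) B"
    using Cons prob_exit_site[OF walk[of p]] measurable_sets[OF fold_meas, of B]
    by (intro emeasure_independent_mixture[OF Z])
      (auto simp: emeasure_eq_measure vimage_def Int_def conj_commute)
  then show ?case
    by (simp add: send_eq_settle[where A = A] settle_pmf_def bind_return_pmf map_pmf_def aggregate_pmf_bind)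
qed

section \<open>Laws of random site sets\<close>

lemma space_site_set_space [simp]: "space site_set_space = UNIV"
  by (simp add: site_set_space_def)

lemma sets_site_set_space: "sets site_set_space = sigma_sets UNIV {{A. z \<in> A} | z. True}"
  by (simp add: site_set_space_def)

lemma supersets_in_site_set_space: "finite F \<Longrightarrow> {A. F \<subseteq> A} \<in> sets site_set_space"
proof (induction F rule: finite_induct)
  case (insert z F)
  have "{A. z \<in> A} \<in> sets site_set_space"
    unfolding sets_site_set_space by (rule sigma_sets.Basic) blast
  with insert have "{A. z \<in> A} \<inter> {A. F \<subseteq> A} \<in> sets site_set_space"
    by blast
  also have "{A. z \<in> A} \<inter> {A. F \<subseteq> A} = {A. insert z F \<subseteq> A}"
    by blast
  finally show ?case .
qed (use sets.top[of site_set_space] in simp)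

lemma sets_site_set_space_supersets:
  "sets site_set_space = sigma_sets UNIV {{A. F \<subseteq> A} | F. finite F}"
proof
  show "sets site_set_space \<subseteq> sigma_sets UNIV {{A. F \<subseteq> A} | F. finite F}"
    unfolding sets_site_set_space
  proof (intro sigma_sets_mono subsetI)
    fix X assume "X \<in> {{A. z \<in> A} | z :: site. True}"
    then obtain z :: site where "X = {A. {z} \<subseteq> A}" by auto
    then show "X \<in> sigma_sets UNIV {{A. F \<subseteq> A} | F. finite F}"
      by (intro sigma_sets.Basic) blast
  qed
  show "sigma_sets UNIV {{A. F \<subseteq> A} | F. finite F} \<subseteq> sets site_set_space"
    using supersets_in_site_set_space
    by (intro sets.sigma_sets_subset[of _ site_set_space, simplified]) auto
qed

text \<open>Covering events generate the sigma-algebra and are stable under intersection, covering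
  \<open>F\<close> and \<open>G\<close> being the same as covering
  \<open>F \<union> G\<close>.\<close>

lemma site_set_measure_eqI:
  assumes "prob_space \<mu>" "prob_space \<nu>" "sets \<mu> = sets site_set_space" "sets \<nu> = sets site_set_space"
    and eq: "\<And>F. finite F \<Longrightarrow> emeasure \<mu> {A. F \<subseteq> A} = emeasure \<nu> {A. F \<subseteq> A}"
  shows "\<mu> = \<nu>"
proof (rule measure_eqI_generator_eq[where E = "{{A. F \<subseteq> A} | F. finite F}" and \<Omega> = UNIV and A = "\<lambda>_. UNIV"])
  show "Int_stable {{A :: site set. F \<subseteq> A} | F. finite F}"
  proof (rule Int_stableI)
    fix X Y :: "site set set"
    assume "X \<in> {{A. F \<subseteq> A} | F. finite F}" "Y \<in> {{A. F \<subseteq> A} | F. finite F}"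
    then obtain F G where "finite F" "finite G" "X = {A. F \<subseteq> A}" "Y = {A. G \<subseteq> A}" by blast
    then have "finite (F \<union> G)" "X \<inter> Y = {A. F \<union> G \<subseteq> A}" by auto
    then show "X \<inter> Y \<in> {{A. F \<subseteq> A} | F. finite F}" by blast
  qed
  show "range (\<lambda>_ :: nat. UNIV) \<subseteq> {{A :: site set. F \<subseteq> A} | F. finite F}"
    by (auto intro!: exI[of _ "{}"])
  interpret \<mu>: prob_space \<mu> by fact
  show "emeasure \<mu> UNIV \<noteq> \<infinity>" for i :: nat
    by simp
qed (use assms in \<open>auto simp: sets_site_set_space_supersets\<close>)

lemma (in prob_space) law_invariantI:
  assumes A: "A \<in> M \<rightarrow>\<^sub>M site_set_space" and "bij f"
    and eq: "\<And>F. finite F \<Longrightarrow> emeasure M {\<omega> \<in> space M. f ` F \<subseteq> A \<omega>} = emeasure M {\<omega> \<in> space M. F \<subseteq> A \<omega>}"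
  shows "law_invariant M A f"
  unfolding law_invariant_def
proof (intro conjI A site_set_measure_eqI)
  let ?D = "distr M site_set_space A"
  note [measurable] = A measurable_image_site_set[OF \<open>bij f\<close>]
  interpret D: prob_space ?D
    by (rule prob_space_distr) measurable
  show "prob_space ?D"
    by (rule D.prob_space_axioms)
  show "prob_space (distr ?D site_set_space ((`) f))"
    by (rule D.prob_space_distr) measurable
  fix F :: "site set" assume F: "finite F"
  have inj: "inj f" and surj: "surj f"
    using \<open>bij f\<close> by (auto simp: bij_def)
  \<comment> \<open>The image of a set under \<open>f\<close> covers \<open>F\<close> exactly if the
    set covers the preimage \<open>G\<close>, so \<open>eq\<close> is applied to
    \<open>G\<close>.\<close>
  define G where "G = f -` F"
  have G: "finite G" "F = f ` G"
    using F inj surj by (auto simp: G_def finite_vimageI surj_image_vimage_eq)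
  note [measurable] = supersets_in_site_set_space[OF F] supersets_in_site_set_space[OF G(1)]
  have "emeasure (distr ?D site_set_space ((`) f)) {A. F \<subseteq> A} = emeasure M {\<omega> \<in> space M. F \<subseteq> f ` A \<omega>}"
    by (simp add: emeasure_distr distr_distr comp_def vimage_def Int_def conj_commute)
  also have "\<dots> = emeasure M {\<omega> \<in> space M. G \<subseteq> A \<omega>}"
    by (simp add: G(2) inj_image_subset_iff[OF inj])
  also have "\<dots> = emeasure M {\<omega> \<in> space M. F \<subseteq> A \<omega>}"
    unfolding G(2) using eq[OF G(1)] by simp
  also have "\<dots> = emeasure ?D {A. F \<subseteq> A}"
    by (simp add: emeasure_distr vimage_def Int_def conj_commute)
  finally show "emeasure (distr ?D site_set_space ((`) f)) {A. F \<subseteq> A} = emeasure ?D {A. F \<subseteq> A}" .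
qed simp_all

section \<open>Particles, levels and monotonicity\<close>

definition start :: "particle \<Rightarrow> site" where
  "start p = (0, fst p)"

lemma distinct_levels: "distinct (levels m)"
  by (induction m) (auto simp: set_levels)

lemma distinct_particles: "distinct (particles c m)"
proof -
  have "distinct (concat (map (\<lambda>i. map (Pair i) [1..<Suc (c i)]) is))" if "distinct is" for "is" :: "int list"
    using that by (induction "is") (auto simp: distinct_map inj_on_def simp del: upt_Suc)
  then show ?thesis
    by (simp add: particles_def distinct_levels del: upt_Suc)
qed

text \<open>The usual order appends the two new levels at the end, so dropping them restores the
  previous list.\<close>

lemma filter_particles: "filter (\<lambda>p. \<bar>fst p\<bar> \<le> int m) (particles c (Suc m)) = particles c m"
proof -
  have "filter (\<lambda>p. \<bar>fst p\<bar> \<le> int m) (particles c m) = particles c m"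
    by (rule filter_True) (auto simp: set_particles)
  moreover have "particles c (Suc m) = particles c m @
      map (Pair (int (Suc m))) [1..<Suc (c (int (Suc m)))] @ map (Pair (- int (Suc m))) [1..<Suc (c (- int (Suc m)))]"
    by (simp add: particles_def del: upt_Suc)
  ultimately show ?thesis
    by (simp add: filter_map comp_def del: upt_Suc)
qed

lemma measurable_particles [measurable]:
  "(\<lambda>c. particles c m) \<in> PiM UNIV (\<lambda>_. count_space UNIV) \<rightarrow>\<^sub>M count_space UNIV"
proof -
  have "(\<lambda>c. concat (map (\<lambda>i. map (Pair i) [1..<Suc (c i)]) is))
      \<in> PiM UNIV (\<lambda>_. count_space UNIV) \<rightarrow>\<^sub>M count_space UNIV" for "is" :: "int list"
  proof (induction "is")
    case (Cons i "is")
    have "(\<lambda>c. map (Pair i) [1..<Suc (c i)]) \<in> PiM UNIV (\<lambda>_. count_space UNIV) \<rightarrow>\<^sub>M count_space UNIV"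
      by (rule measurable_compose[of "\<lambda>c. c i" _ "count_space UNIV"]) auto
    then have "(\<lambda>c. (\<lambda>xs c. xs @ concat (map (\<lambda>i. map (Pair i) [1..<Suc (c i)]) is)) (map (Pair i) [1..<Suc (c i)]) c)
        \<in> PiM UNIV (\<lambda>_. count_space UNIV) \<rightarrow>\<^sub>M count_space UNIV"
      by (rule measurable_compose_countable[rotated]) (rule measurable_compose[OF Cons], simp)
    then show ?case
      by (simp only: list.map concat.simps)
  qed simp
  then show ?thesis
    by (simp add: particles_def)
qed

section \<open>Monotonicity along fixed trajectories\<close>

lemma send_mono:
  assumes "A \<subseteq> B"
  shows "send w A \<subseteq> send w B"
proof (cases "exit_site A w")
  case (Some z)
  then obtain t where t: "\<forall>u<t. w u \<in> A" "w t = z" by (auto simp: exit_site_eq_Some_iff)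
  show ?thesis
  \<comment> \<open>If the exit site \<open>z\<close> from \<open>A\<close> is already in
    \<open>B\<close>, nothing is added on the left; otherwise the walk leaves \<open>B\<close> at
    \<open>z\<close> as well.\<close>
  proof (cases "z \<in> B")
    case False
    with t assms have "exit_site B w = Some z" by (auto simp: exit_site_eq_Some_iff)
    with Some assms show ?thesis by (auto simp: send_eq_settle settle_def)
  qed (use Some assms in \<open>auto simp: send_eq_settle settle_def\<close>)
qed (use assms in \<open>auto simp: send_eq_settle settle_def\<close>)

text \<open>A kept particle preserves the inclusion by \<open>send_mono\<close>, a dropped one only
  enlarges the right side. Dropped particles may stand anywhere in the list, as they do under
  arrival times.\<close>

lemma fold_send_filter_mono:
  "A \<subseteq> B \<Longrightarrow> fold (\<lambda>p. send (w p)) (filter Q ps) A \<subseteq> fold (\<lambda>p. send (w p)) ps B"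
proof (induction ps arbitrary: A B)
  case (Cons p ps)
  moreover have "B \<subseteq> send (w p) B"
    by (simp add: send_eq_settle settle_def)
  ultimately show ?case
    using send_mono[OF Cons.prems, of "w p"] by auto
qed simp

definition level_cover_prob :: "site set \<Rightarrow> nat \<Rightarrow> (int \<Rightarrow> nat) \<Rightarrow> real" where
  "level_cover_prob F m c = cover_prob F (map start (particles c m))"

text \<open>\<open>\<sigma>\<close> is the action of \<open>f\<close> on levels. The bound says that
  levels up to \<open>m\<close> have their preimages among the levels up to
  \<open>m + K\<close>.\<close>

definition axis_symmetry :: "nat \<Rightarrow> (site \<Rightarrow> site) \<Rightarrow> bool" where
  "axis_symmetry K f \<longleftrightarrow> lattice_symmetry f \<and>
    (\<exists>\<sigma>. bij \<sigma> \<and> (\<forall>i. f (0, i) = (0, \<sigma> i) \<and> \<bar>i\<bar> \<le> \<bar>\<sigma> i\<bar> + int K))"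

lemma level_cover_prob_symmetry:
  assumes f: "lattice_symmetry f" and "bij \<sigma>" and \<sigma>: "\<And>i. f (0, i) = (0, \<sigma> i)" "\<And>i. \<bar>i\<bar> \<le> \<bar>\<sigma> i\<bar> + int K"
  shows "level_cover_prob (f ` F) m c \<le> level_cover_prob F (m + K) (\<lambda>i. c (\<sigma> i))"
proof -
  define \<phi> :: "particle \<Rightarrow> particle" where "\<phi> = map_prod \<sigma> id"
  have inj: "inj \<phi>"
    unfolding \<phi>_def using \<open>bij \<sigma>\<close> by (intro prod.inj_map) (auto simp: bij_def)
  have f_start: "f (start p) = start (\<phi> p)" for p
    by (simp add: start_def \<sigma> \<phi>_def)
  let ?ps = "particles (\<lambda>i. c (\<sigma> i)) (m + K)"
  have "p \<in> \<phi> ` set ?ps" if "p \<in> set (particles c m)" for p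
  proof -
    obtain j k where p: "p = (j, k)" by (cases p)
    obtain i where i: "j = \<sigma> i" using bij_is_surj[OF \<open>bij \<sigma>\<close>] by blast
    have "(i, k) \<in> set ?ps"
      using that \<sigma>(2)[of i] unfolding p i by (auto simp: set_particles)
    moreover have "p = \<phi> (i, k)"
      by (simp add: p i \<phi>_def)
    ultimately show ?thesis by blast
  qed
  \<comment> \<open>The lists are distinct, so inclusion of sets gives inclusion of multisets, which
    survives passing to starting points.\<close>
  then have "mset (particles c m) \<subseteq># mset (map \<phi> ?ps)"
    using distinct_particles[of c m] distinct_particles[of "\<lambda>i. c (\<sigma> i)" "m + K"] inj
    by (subst (1 2) mset_set_set[symmetric])
      (auto simp: distinct_map inj_on_def inj_def intro!: subset_imp_msubset_mset_set)
  then have "mset (map start (particles c m)) \<subseteq># mset (map start (map \<phi> ?ps))"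
    unfolding mset_map by (rule image_mset_subseteq_mono)
  then have "cover_prob (f ` F) (map start (particles c m)) \<le> cover_prob (f ` F) (map f (map start ?ps))"
    by (intro cover_prob_mono) (simp add: f_start comp_def)
  then show ?thesis
    by (simp only: level_cover_prob_def cover_prob_symmetry[OF f])
qed

section \<open>Invariance for randomly ordered particles\<close>

text \<open>A common frame for the three aggregates: \<open>c\<close> gives the number of particles
  per level, and \<open>L m\<close> the possibly random order of those up to level \<open>m\<close>.
  \<open>filter_L\<close> makes the aggregates increase with \<open>m\<close>;
  \<open>exchangeable_c\<close> lets a symmetry permute the levels.\<close>

locale ordered_aggregates = prob_space M
  for M :: "'w measure" +
  fixes W :: "particle \<Rightarrow> 'w \<Rightarrow> nat \<Rightarrow> site" and c :: "int \<Rightarrow> 'w \<Rightarrow> nat" and L :: "nat \<Rightarrow> 'w \<Rightarrow> particle list"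
  assumes walk: "\<And>p. p \<in> particle_index \<Longrightarrow> simple_random_walk M (start p) (W p)"
    and indep_walks: "indep_vars (\<lambda>_. trajectory_space) W particle_index"
    and measurable_L [measurable]: "\<And>m. L m \<in> M \<rightarrow>\<^sub>M count_space UNIV"
    and mset_L: "\<And>m \<omega>. \<omega> \<in> space M \<Longrightarrow> mset (L m \<omega>) = mset (particles (\<lambda>i. c i \<omega>) m)"
    and filter_L: "\<And>m \<omega>. \<omega> \<in> space M \<Longrightarrow> filter (\<lambda>p. \<bar>fst p\<bar> \<le> int m) (L (Suc m) \<omega>) = L m \<omega>"
    and indep_L: "\<And>m ps B. set ps \<subseteq> particle_index \<Longrightarrow>
      emeasure M {\<omega> \<in> space M. L m \<omega> = ps \<and> aggregate (\<lambda>p. W p \<omega>) ps \<in> B} =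
      emeasure M {\<omega> \<in> space M. L m \<omega> = ps} * emeasure M {\<omega> \<in> space M. aggregate (\<lambda>p. W p \<omega>) ps \<in> B}"
    and measurable_c [measurable]: "(\<lambda>\<omega> i. c i \<omega>) \<in> M \<rightarrow>\<^sub>M PiM UNIV (\<lambda>_. count_space UNIV)"
    and exchangeable_c: "\<And>\<sigma>. bij \<sigma> \<Longrightarrow> distr M (PiM UNIV (\<lambda>_. count_space UNIV)) (\<lambda>\<omega> i. c (\<sigma> i) \<omega>) =
      distr M (PiM UNIV (\<lambda>_. count_space UNIV)) (\<lambda>\<omega> i. c i \<omega>)"
begin

definition agg :: "nat \<Rightarrow> 'w \<Rightarrow> site set" where
  "agg m \<omega> = aggregate (\<lambda>p. W p \<omega>) (L m \<omega>)"

text \<open>Lists that \<open>L\<close> does not produce may have repetitions or particles without a walk; normalizing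
  makes the statements about an arbitrary value of \<open>L\<close> unconditional.\<close>

definition norm_list :: "particle list \<Rightarrow> particle list" where
  "norm_list ps = remdups (filter (\<lambda>p. p \<in> particle_index) ps)"

lemma norm_list: "distinct (norm_list ps)" "set (norm_list ps) \<subseteq> particle_index"
  by (auto simp: norm_list_def)

lemma distinct_L: "\<omega> \<in> space M \<Longrightarrow> distinct (L m \<omega>)"
  using mset_eq_imp_distinct_iff[OF mset_L] distinct_particles by blast

lemma set_L: "\<omega> \<in> space M \<Longrightarrow> set (L m \<omega>) \<subseteq> particle_index"
  using mset_eq_setD[OF mset_L] by (fastforce simp: set_particles particle_index_def)

lemma norm_list_L: "\<omega> \<in> space M \<Longrightarrow> norm_list (L m \<omega>) = L m \<omega>"
  using distinct_L[of \<omega> m] set_L[of \<omega> m] unfolding norm_list_def by (subst filter_True) auto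

lemma measurable_aggregate_list:
  "(\<lambda>\<omega>. aggregate (\<lambda>p. W p \<omega>) (norm_list ps)) \<in> M \<rightarrow>\<^sub>M count_space UNIV"
  unfolding aggregate_def
  using walk norm_list(2)[of ps] by (intro measurable_fold_send) (auto simp: simple_random_walk_def)

lemma measurable_agg: "agg m \<in> M \<rightarrow>\<^sub>M count_space UNIV"
proof -
  have "(\<lambda>\<omega>. (\<lambda>ps \<omega>. aggregate (\<lambda>p. W p \<omega>) (norm_list ps)) (L m \<omega>) \<omega>) \<in> M \<rightarrow>\<^sub>M count_space UNIV"
    by (rule measurable_compose_countable[OF measurable_aggregate_list measurable_L])
  then show ?thesis
    by (rule measurable_cong[THEN iffD1, rotated]) (simp add: agg_def norm_list_L)
qed

lemma sets_agg [measurable]: "{\<omega> \<in> space M. F \<subseteq> agg m \<omega>} \<in> sets M"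
  using measurable_sets[OF measurable_agg, of "{A. F \<subseteq> A}" m]
  by (simp add: vimage_def Int_def conj_commute)

lemma emeasure_agg:
  "emeasure M {\<omega> \<in> space M. F \<subseteq> agg m \<omega>} = (\<integral>\<^sup>+\<omega>. level_cover_prob F m (\<lambda>i. c i \<omega>) \<partial>M)"
proof -
  define p where "p = embed_pmf (\<lambda>ps. prob {\<omega> \<in> space M. L m \<omega> = ps})"
  have p: "pmf p ps = prob {\<omega> \<in> space M. L m \<omega> = ps}" for ps
    unfolding p_def by (rule pmf_embed_pmf_discrete) measurable
  have law_L: "distr M (count_space UNIV) (L m) = measure_pmf p"
  proof (rule measure_eqI_countable[where A = UNIV])
    fix ps
    show "emeasure (distr M (count_space UNIV) (L m)) {ps} = emeasure (measure_pmf p) {ps}"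
      by (simp add: emeasure_distr emeasure_pmf_single p emeasure_eq_measure vimage_def Int_def conj_commute)
  qed auto
  define R where "R ps = aggregate_pmf (map start (norm_list ps)) (return_pmf {})" for ps
  define Q where "Q ps \<omega> \<longleftrightarrow> aggregate (\<lambda>p. W p \<omega>) (norm_list ps) \<in> {A. F \<subseteq> A}" for ps \<omega>
  have Q: "{\<omega> \<in> space M. Q ps \<omega>} \<in> sets M" for ps
    using measurable_sets[OF measurable_aggregate_list, of "{A. F \<subseteq> A}" ps]
    by (simp add: Q_def vimage_def Int_def conj_commute)
  have "{\<omega> \<in> space M. F \<subseteq> agg m \<omega>} = {\<omega> \<in> space M. Q (L m \<omega>) \<omega>}"
    by (auto simp: Q_def agg_def norm_list_L)
  also have "emeasure M \<dots> = emeasure (bind_pmf p R) {A. F \<subseteq> A}"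
  proof (rule emeasure_independent_mixture[OF measurable_L _ Q])
    fix ps
    show "emeasure M {\<omega> \<in> space M. L m \<omega> = ps} = ennreal (pmf p ps)"
      by (simp add: p emeasure_eq_measure)
    show "emeasure M {\<omega> \<in> space M. Q ps \<omega>} = emeasure (R ps) {A. F \<subseteq> A}"
      unfolding Q_def R_def aggregate_def
      by (rule emeasure_fold_send[OF indep_walks walk norm_list])
    show "emeasure M {\<omega> \<in> space M. L m \<omega> = ps \<and> Q ps \<omega>} =
        emeasure M {\<omega> \<in> space M. L m \<omega> = ps} * emeasure M {\<omega> \<in> space M. Q ps \<omega>}"
    proof (cases "norm_list ps = ps")
      case True
      then show ?thesis
        unfolding Q_def using indep_L[of ps m "{A. F \<subseteq> A}"] norm_list(2)[of ps] by simp
    next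
      case False
      then have "{\<omega> \<in> space M. L m \<omega> = ps} = {}"
        using norm_list_L by auto
      moreover from this have "{\<omega> \<in> space M. L m \<omega> = ps \<and> Q ps \<omega>} = {}"
        by blast
      ultimately show ?thesis by (simp only: emeasure_empty mult_zero_left)
    qed
  qed
  also have "\<dots> = (\<integral>\<^sup>+\<omega>. emeasure (R (L m \<omega>)) {A. F \<subseteq> A} \<partial>M)"
    by (simp add: nn_integral_distr flip: law_L)
  also have "\<dots> = (\<integral>\<^sup>+\<omega>. level_cover_prob F m (\<lambda>i. c i \<omega>) \<partial>M)"
  \<comment> \<open>Here the order disappears: \<open>L m\<close> lists the same multiset as the
    usual order, so only the counts matter.\<close>
  proof (rule nn_integral_cong)
    fix \<omega> assume "\<omega> \<in> space M"
    then have "aggregate_pmf (map start (norm_list (L m \<omega>))) = aggregate_pmf (map start (particles (\<lambda>i. c i \<omega>) m))"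
      by (intro aggregate_pmf_cong_mset) (simp add: norm_list_L mset_L)
    then show "emeasure (R (L m \<omega>)) {A. F \<subseteq> A} = ennreal (level_cover_prob F m (\<lambda>i. c i \<omega>))"
      by (simp add: R_def level_cover_prob_def cover_prob_def measure_pmf.emeasure_eq_measure)
  qed
  finally show ?thesis .
qed

text \<open>The bound for fixed counts is integrated over the counts, and exchangeability then
  removes \<open>\<sigma>\<close>.\<close>

lemma emeasure_agg_symmetry:
  assumes "axis_symmetry K f"
  shows "emeasure M {\<omega> \<in> space M. f ` F \<subseteq> agg m \<omega>} \<le> emeasure M {\<omega> \<in> space M. F \<subseteq> agg (m + K) \<omega>}"
proof -
  obtain \<sigma> where f: "lattice_symmetry f" and \<sigma>: "bij \<sigma>" "\<And>i. f (0, i) = (0, \<sigma> i)" "\<And>i. \<bar>i\<bar> \<le> \<bar>\<sigma> i\<bar> + int K"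
    using assms unfolding axis_symmetry_def by blast
  let ?\<Pi> = "PiM UNIV (\<lambda>_ :: int. count_space (UNIV :: nat set))"
  let ?h = "\<lambda>c. ennreal (level_cover_prob F (m + K) c)"
  have h [measurable]: "?h \<in> borel_measurable ?\<Pi>"
    unfolding level_cover_prob_def by (rule measurable_compose[OF measurable_particles]) simp
  have [measurable]: "(\<lambda>\<omega> i. c (\<sigma> i) \<omega>) \<in> M \<rightarrow>\<^sub>M ?\<Pi>"
    by (rule measurable_PiM_single') (use measurable_c in \<open>auto intro: measurable_compose[OF measurable_c]\<close>)
  have "emeasure M {\<omega> \<in> space M. f ` F \<subseteq> agg m \<omega>} \<le> (\<integral>\<^sup>+\<omega>. ?h (\<lambda>i. c (\<sigma> i) \<omega>) \<partial>M)"
    unfolding emeasure_agg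
    by (intro nn_integral_mono ennreal_leI) (rule level_cover_prob_symmetry[OF f \<sigma>])
  also have "\<dots> = (\<integral>\<^sup>+c. ?h c \<partial>distr M ?\<Pi> (\<lambda>\<omega> i. c (\<sigma> i) \<omega>))"
    by (simp add: nn_integral_distr)
  also have "\<dots> = emeasure M {\<omega> \<in> space M. F \<subseteq> agg (m + K) \<omega>}"
    unfolding exchangeable_c[OF \<sigma>(1)] by (simp add: nn_integral_distr emeasure_agg)
  finally show ?thesis .
qed

section \<open>Passage to infinitely many levels\<close>

lemma agg_mono:
  assumes "\<omega> \<in> space M" "m \<le> m'"
  shows "agg m \<omega> \<subseteq> agg m' \<omega>"
proof (rule lift_Suc_mono_le[of "\<lambda>m. agg m \<omega>", OF _ assms(2)])
  fix m
  show "agg m \<omega> \<subseteq> agg (Suc m) \<omega>"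
    unfolding agg_def aggregate_def filter_L[OF assms(1), of m, symmetric]
    by (rule fold_send_filter_mono) simp
qed

text \<open>A finite set covered by an increasing union is covered by one of its members, so
  continuity from below applies.\<close>

lemma emeasure_agg_inf:
  assumes "finite F"
  shows "emeasure M {\<omega> \<in> space M. F \<subseteq> (\<Union>m. agg m \<omega>)} = (SUP m. emeasure M {\<omega> \<in> space M. F \<subseteq> agg m \<omega>})"
proof -
  have "\<exists>m. F \<subseteq> agg m \<omega>" if "\<omega> \<in> space M" "F \<subseteq> (\<Union>m. agg m \<omega>)" for \<omega>
    using assms that(2)
  proof (induction F rule: finite_induct)
    case (insert z F)
    then obtain a b where "z \<in> agg a \<omega>" "F \<subseteq> agg b \<omega>" by auto
    then have "insert z F \<subseteq> agg (max a b) \<omega>"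
      using agg_mono[OF that(1), of a "max a b"] agg_mono[OF that(1), of b "max a b"] by auto
    then show ?case ..
  qed simp
  then have "{\<omega> \<in> space M. F \<subseteq> (\<Union>m. agg m \<omega>)} = (\<Union>m. {\<omega> \<in> space M. F \<subseteq> agg m \<omega>})"
    by blast
  also have "emeasure M \<dots> = (SUP m. emeasure M {\<omega> \<in> space M. F \<subseteq> agg m \<omega>})"
  proof (rule SUP_emeasure_incseq[symmetric])
    show "incseq (\<lambda>m. {\<omega> \<in> space M. F \<subseteq> agg m \<omega>})"
      using agg_mono by (intro monoI) blast
  qed auto
  finally show ?thesis .
qed

lemma law_invariant_agg_inf:
  assumes f: "axis_symmetry K f" and g: "axis_symmetry K' g" "\<And>z. g (f z) = z"
    and A: "\<And>\<omega>. A \<omega> = (\<Union>m. agg m \<omega>)"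
  shows "law_invariant M A f"
proof (rule law_invariantI)
  show "bij f"
    using f by (simp add: axis_symmetry_def lattice_symmetry_def)
  show "A \<in> M \<rightarrow>\<^sub>M site_set_space"
    unfolding site_set_space_def
  proof (rule measurable_measure_of)
    fix Y assume "Y \<in> {{A. z \<in> A} | z :: site. True}"
    then obtain z where Y: "Y = {A. z \<in> A}" by blast
    have "A -` Y \<inter> space M = (\<Union>m. {\<omega> \<in> space M. {z} \<subseteq> agg m \<omega>})"
      by (auto simp: A Y)
    then show "A -` Y \<inter> space M \<in> sets M"
      by (simp del: insert_subset)
  qed auto
  fix F :: "site set" assume F: "finite F"
  \<comment> \<open>The shift from \<open>m\<close> to \<open>m + k\<close> is absorbed by the
    supremum. Using this for \<open>f\<close> with \<open>F\<close>, and for \<open>g\<close> with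
    the image of \<open>F\<close> under \<open>f\<close>, gives both inequalities.\<close>
  have le: "emeasure M {\<omega> \<in> space M. h ` G \<subseteq> A \<omega>} \<le> emeasure M {\<omega> \<in> space M. G \<subseteq> A \<omega>}"
    if "axis_symmetry k h" "finite G" for h k G
    unfolding A emeasure_agg_inf[OF that(2)] emeasure_agg_inf[OF finite_imageI[OF that(2)]]
    using emeasure_agg_symmetry[OF that(1)] by (intro SUP_mono) blast
  have "g ` f ` F = F"
    by (simp add: image_comp comp_def g(2))
  then show "emeasure M {\<omega> \<in> space M. f ` F \<subseteq> A \<omega>} = emeasure M {\<omega> \<in> space M. F \<subseteq> A \<omega>}"
    using le[OF f F] le[OF g(1) finite_imageI[OF F, of f]] by simp
qed

end

section \<open>Translations and reflections\<close>

lemma axis_symmetry_translation: "axis_symmetry (nat \<bar>k\<bar>) (translation k)"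
proof -
  have "lattice_symmetry (translation k)"
    unfolding lattice_symmetry_def
    by (intro conjI bij_translation exI[of _ "\<lambda>d. d"]) (auto simp: translation_def)
  moreover have "bij (\<lambda>i :: int. i + k)"
    by (rule bij_betw_byWitness[where f' = "\<lambda>i. i - k"]) auto
  ultimately show ?thesis
    unfolding axis_symmetry_def by (intro conjI exI[of _ "\<lambda>i. i + k"]) (auto simp: translation_def)
qed

lemma axis_symmetry_reflection: "axis_symmetry (nat \<bar>k\<bar>) (reflection k)"
proof -
  have "inj (\<lambda>(x :: int, y :: int). (x, - y))"
    by (auto simp: inj_def)
  then have "map_pmf (\<lambda>(x, y). (x, - y)) walk_step = walk_step"
    unfolding walk_step_def
    by (subst map_pmf_of_set_inj) (auto intro: inj_on_subset arg_cong[where f = pmf_of_set])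
  then have "lattice_symmetry (reflection k)"
    unfolding lattice_symmetry_def
    by (intro conjI bij_reflection exI[of _ "\<lambda>(x, y). (x, - y)"]) (auto simp: reflection_def)
  moreover have "bij (\<lambda>i :: int. k - i)"
    by (rule bij_betw_byWitness[where f' = "\<lambda>i. k - i"]) auto
  ultimately show ?thesis
    unfolding axis_symmetry_def by (intro conjI exI[of _ "\<lambda>i. k - i"]) (auto simp: reflection_def)
qed

lemma (in ordered_aggregates) law_invariant_translation_reflection:
  assumes "\<And>\<omega>. A \<omega> = (\<Union>m. agg m \<omega>)"
  shows "law_invariant M A (translation k) \<and> law_invariant M A (reflection k)"
  \<comment> \<open>The inverses are the translation by \<open>- k\<close> and the reflection
    itself.\<close>
  using law_invariant_agg_inf[OF axis_symmetry_translation axis_symmetry_translation[of "- k"] _ assms]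
    law_invariant_agg_inf[OF axis_symmetry_reflection axis_symmetry_reflection[of k] _ assms]
  by (auto simp: translation_def reflection_def)

section \<open>Random particle numbers\<close>

text \<open>Both sides are the product of copies of \<open>D\<close>, which a permutation of the
  indices preserves.\<close>

lemma (in prob_space) distr_iid_reindex:
  assumes indep: "indep_vars (\<lambda>_. N) X UNIV" and law: "\<And>i. distr M N (X i) = D" and "bij \<sigma>"
  shows "distr M (PiM UNIV (\<lambda>_. N)) (\<lambda>\<omega> i. X (\<sigma> i) \<omega>) = distr M (PiM UNIV (\<lambda>_. N)) (\<lambda>\<omega> i. X i \<omega>)"
proof -
  have X: "X i \<in> M \<rightarrow>\<^sub>M N" for i
    using indep by (simp add: indep_vars_def)
  then have m: "(\<lambda>\<omega> i. X i \<omega>) \<in> M \<rightarrow>\<^sub>M PiM UNIV (\<lambda>_. N)"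
    by (intro measurable_PiM_single') (auto dest: measurable_space)
  have D: "prob_space D" "sets D = sets N"
    unfolding law[of undefined, symmetric] by (simp_all add: prob_space_distr X)
  have r: "(\<lambda>x i. x (\<sigma> i)) \<in> PiM UNIV (\<lambda>_. N) \<rightarrow>\<^sub>M PiM UNIV (\<lambda>_. N)"
    by (rule measurable_PiM_single') (auto simp: space_PiM)
  have "distr M (PiM UNIV (\<lambda>_. N)) (\<lambda>\<omega> i. X (\<sigma> i) \<omega>) =
      distr (PiM UNIV (\<lambda>_. D)) (PiM UNIV (\<lambda>_. N)) (\<lambda>x i. x (\<sigma> i))"
    unfolding distr_indep_vars[OF indep law, symmetric] by (simp add: distr_distr[OF r m] comp_def)
  also have "\<dots> = distr (PiM UNIV (\<lambda>_. D)) (PiM UNIV (\<lambda>_. D)) (\<lambda>x i. x (\<sigma> i))"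
    by (rule distr_cong[OF refl sets_PiM_cong[OF refl D(2)[symmetric]] refl])
  also have "\<dots> = PiM UNIV (\<lambda>_. D)"
    using distr_PiM_reindex[of UNIV "\<lambda>_. D" \<sigma> UNIV] D(1) \<open>bij \<sigma>\<close> by (simp add: bij_def restrict_def)
  finally show ?thesis
    unfolding distr_indep_vars[OF indep law] .
qed

lemma poisson_distributed_distr_eq:
  assumes "prob_space P" "poisson_distributed P r X" "poisson_distributed P r Y"
  shows "distr P (count_space UNIV) X = distr P (count_space UNIV) Y"
proof (rule measure_eqI_countable[where A = UNIV])
  interpret prob_space P by fact
  fix k
  have "emeasure (distr P (count_space UNIV) Z) {k} = ennreal (exp (- r) * r ^ k / fact k)"
    if "poisson_distributed P r Z" for Z
    using that by (simp add: poisson_distributed_def emeasure_distr emeasure_eq_measure vimage_def Int_def conj_commute)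
  then show "emeasure (distr P (count_space UNIV) X) {k} = emeasure (distr P (count_space UNIV) Y) {k}"
    using assms by simp
qed (use assms in \<open>auto simp: poisson_distributed_def prob_space.emeasure_space_1 emeasure_distr\<close>)

lemma aggregate_walk_family:
  assumes "set ps \<subseteq> particle_index"
  shows "aggregate (walk_family S \<omega>) ps = aggregate (\<lambda>p. (case p of (i, j) \<Rightarrow> S i j) \<omega>) ps"
  unfolding aggregate_def using assms
  by (intro fold_cong refl) (auto simp: walk_family_def)

text \<open>Once the list \<open>ps\<close> is fixed, the aggregate is a function of the walks alone
  and the event \<open>ord (Y \<omega>) = ps\<close> one of \<open>Y\<close> alone.\<close>

lemma independent_order:
  assumes P: "prob_space P" and indep: "independent_of P K Y walk_family_space (walk_family S)"
    and ord: "ord \<in> K \<rightarrow>\<^sub>M count_space UNIV" and ps: "set ps \<subseteq> particle_index"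
  shows "emeasure P {\<omega> \<in> space P. ord (Y \<omega>) = ps \<and> aggregate (\<lambda>p. (case p of (i, j) \<Rightarrow> S i j) \<omega>) ps \<in> B} =
    emeasure P {\<omega> \<in> space P. ord (Y \<omega>) = ps} *
    emeasure P {\<omega> \<in> space P. aggregate (\<lambda>p. (case p of (i, j) \<Rightarrow> S i j) \<omega>) ps \<in> B}"
    (is "_ = emeasure P ?O * emeasure P ?A")
proof -
  interpret prob_space P by fact
  have Y: "Y \<in> P \<rightarrow>\<^sub>M K" and F: "walk_family S \<in> P \<rightarrow>\<^sub>M walk_family_space"
    and ind: "indep_set {Y -` A \<inter> space P | A. A \<in> sets K}
      {walk_family S -` B \<inter> space P | B. B \<in> sets walk_family_space}"
    using indep by (auto simp: independent_of_def)
  have "(\<lambda>w. aggregate w ps) \<in> walk_family_space \<rightarrow>\<^sub>M count_space UNIV"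
    unfolding aggregate_def walk_family_space_def
    using ps by (intro measurable_fold_send measurable_component_singleton) auto
  then have "(\<lambda>w. aggregate w ps) -` B \<inter> space walk_family_space \<in> sets walk_family_space"
    by (rule measurable_sets) simp
  moreover have "ord -` {ps} \<inter> space K \<in> sets K"
    using ord by (rule measurable_sets) simp
  ultimately have "prob ((Y -` (ord -` {ps} \<inter> space K) \<inter> space P) \<inter>
        (walk_family S -` ((\<lambda>w. aggregate w ps) -` B \<inter> space walk_family_space) \<inter> space P)) =
      prob (Y -` (ord -` {ps} \<inter> space K) \<inter> space P) *
      prob (walk_family S -` ((\<lambda>w. aggregate w ps) -` B \<inter> space walk_family_space) \<inter> space P)"
    by (intro indep_setD[OF ind]) blast+
  moreover have "Y -` (ord -` {ps} \<inter> space K) \<inter> space P = ?O"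
    using measurable_space[OF Y] by auto
  moreover have "walk_family S -` ((\<lambda>w. aggregate w ps) -` B \<inter> space walk_family_space) \<inter> space P = ?A"
    using measurable_space[OF F] by (auto simp: aggregate_walk_family[OF ps])
  ultimately have "prob (?O \<inter> ?A) = prob ?O * prob ?A"
    by (simp only:)
  moreover have "{\<omega> \<in> space P. ord (Y \<omega>) = ps \<and> aggregate (\<lambda>p. (case p of (i, j) \<Rightarrow> S i j) \<omega>) ps \<in> B} = ?O \<inter> ?A"
    by blast
  ultimately show ?thesis
    by (simp only: emeasure_eq_measure ennreal_mult measure_nonneg)
qed

section \<open>Arrival orders\<close>

lemma space_point_space: "space point_space = point_configs"
  by (simp add: point_space_def space_measure_of_conv)

lemma measurable_count_points:
  "(\<lambda>X. card (X \<inter> {..t})) \<in> point_space \<rightarrow>\<^sub>M count_space UNIV"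
proof (subst measurable_count_space_eq2_countable, intro conjI ballI)
  fix k :: nat
  \<comment> \<open>The generators of \<open>point_space\<close> count points in bounded sets; as
    points are nonnegative, \<open>{0..t}\<close> can replace \<open>{..t}\<close>.\<close>
  have "(\<lambda>X. card (X \<inter> {..t})) -` {k} \<inter> space point_space = {X \<in> point_configs. card (X \<inter> {0..t}) = k}"
  proof -
    have "X \<inter> {..t} = X \<inter> {0..t}" if "X \<in> point_configs" for X
      using that by (auto simp: point_configs_def)
    then show ?thesis by (auto simp: space_point_space)
  qed
  also have "\<dots> \<in> sets point_space"
    unfolding point_space_def by (rule in_measure_of) (auto intro!: exI[of _ "{0..t}"])
  finally show "(\<lambda>X. card (X \<inter> {..t})) -` {k} \<inter> space point_space \<in> sets point_space" .
qed auto

lemma arrival_nonneg: "X \<in> point_configs \<Longrightarrow> 0 \<le> arrival X j"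
  unfolding arrival_def by (rule INF_greatest) (auto simp: point_configs_def)

text \<open>Index 0 names no particle, but the sorting keys must be measurable for all pairs; a
  point always counts itself, so the value is that of index 1.\<close>

lemma arrival_0: "X \<in> point_configs \<Longrightarrow> arrival X 0 = arrival X 1"
proof -
  assume X: "X \<in> point_configs"
  have "1 \<le> card (X \<inter> {..t})" if "t \<in> X" for t
    using that X by (auto simp: point_configs_def Suc_le_eq card_gt_0_iff)
  then show ?thesis
    unfolding arrival_def by (intro arg_cong[where f = "\<lambda>A. Inf (ereal ` A)"]) auto
qed

lemma measurable_arrival: "(\<lambda>X. arrival X j) \<in> borel_measurable point_space"
proof -
  have *: "(\<lambda>X. arrival X j) \<in> borel_measurable point_space" if j: "1 \<le> j" for j
    unfolding borel_measurable_iff_Iic_ereal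
  proof
    fix a :: ereal
    show "(\<lambda>X. arrival X j) -` {..a} \<inter> space point_space \<in> sets point_space"
    proof (cases a)
      case (real t)
      have "(\<lambda>X. arrival X j) -` {..a} \<inter> space point_space =
          (\<lambda>X. card (X \<inter> {..t})) -` {j..} \<inter> space point_space"
        by (auto simp: space_point_space real arrival_le_iff[OF _ j])
      then show ?thesis
        using measurable_sets[OF measurable_count_points, of "{j..}" t] by simp
    next
      case MInf
      then have "(\<lambda>X. arrival X j) -` {..a} \<inter> space point_space = {}"
        using arrival_nonneg[of _ j] by (force simp: space_point_space)
      then show ?thesis by simp
    next
      case PInf
      then have "(\<lambda>X. arrival X j) -` {..a} \<inter> space point_space = space point_space"
        by auto
      then show ?thesis by simp
    qed
  qed
  show ?thesis
  proof (cases "j = 0")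
    case True
    then show ?thesis
      using *[of 1] by (subst measurable_cong[where g = "\<lambda>X. arrival X 1"]) (simp_all add: space_point_space arrival_0)
  qed (use * in auto)
qed

text \<open>Insertion sort makes finitely many comparisons of measurable keys, and its intermediate
  lists form a countable type.\<close>

lemma measurable_sort_key:
  fixes f :: "'a \<Rightarrow> 'p :: countable \<Rightarrow> ereal"
  assumes f [measurable]: "\<And>p. (\<lambda>\<omega>. f \<omega> p) \<in> borel_measurable M"
  shows "(\<lambda>\<omega>. sort_key (f \<omega>) ps) \<in> M \<rightarrow>\<^sub>M count_space UNIV"
proof (induction ps)
  case (Cons p ps)
  have "(\<lambda>\<omega>. insort_key (f \<omega>) p qs) \<in> M \<rightarrow>\<^sub>M count_space UNIV" for qs
  proof (induction qs)
    case (Cons q qs)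
    have [measurable]: "(\<lambda>\<omega>. q # insort_key (f \<omega>) p qs) \<in> M \<rightarrow>\<^sub>M count_space UNIV"
      by (rule measurable_compose[OF Cons]) simp
    show ?case
      by simp
  qed simp
  from measurable_compose_countable[OF this Cons] show ?case
    by simp
qed simp

lemma measurable_timed_particles:
  "(\<lambda>X. timed_particles X t m) \<in> PiM UNIV (\<lambda>_. point_space) \<rightarrow>\<^sub>M count_space UNIV"
proof -
  have [measurable]: "(\<lambda>X i. card (X i \<inter> {..t})) \<in> PiM UNIV (\<lambda>_ :: int. point_space) \<rightarrow>\<^sub>M PiM UNIV (\<lambda>_. count_space UNIV)"
    by (rule measurable_PiM_single') (auto intro: measurable_compose[OF _ measurable_count_points])
  have "(\<lambda>X. sort_key (\<lambda>(i, j). arrival (X i) j) ps) \<in> PiM UNIV (\<lambda>_ :: int. point_space) \<rightarrow>\<^sub>M count_space UNIV" for ps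
    by (rule measurable_sort_key) (auto simp: split_def intro: measurable_compose[OF _ measurable_arrival])
  then have "(\<lambda>X. (\<lambda>ps X. sort_key (\<lambda>(i, j). arrival (X i) j) ps) (particles (\<lambda>i. card (X i \<inter> {..t})) m) X)
      \<in> PiM UNIV (\<lambda>_. point_space) \<rightarrow>\<^sub>M count_space UNIV"
    by (rule measurable_compose_countable) (rule measurable_compose[OF _ measurable_particles], measurable)
  then show ?thesis
    by (simp add: timed_particles_def)
qed

text \<open>Stable sorting commutes with filtering, so ties are also resolved consistently in
  \<open>m\<close>.\<close>

lemma filter_timed_particles:
  "filter (\<lambda>p. \<bar>fst p\<bar> \<le> int m) (timed_particles X t (Suc m)) = timed_particles X t m"
  unfolding timed_particles_def filter_sort filter_particles ..

section \<open>Invariance of the three aggregates\<close>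

theorem proposition2p2:
  fixes P :: "'w measure"
    and S :: "int \<Rightarrow> nat \<Rightarrow> 'w \<Rightarrow> nat \<Rightarrow> int \<times> int"
    and N :: "int \<Rightarrow> 'w \<Rightarrow> nat"
    and X :: "int \<Rightarrow> 'w \<Rightarrow> real set"
    and n :: nat
  assumes "prob_space P"
    and "independent_walks P S"
    and "iid_poisson_indep_of_walks P S (real n) N"
    and "iid_poisson_processes_indep_of_walks P S 1 X"
  shows "(\<forall>k. law_invariant P (A_fixed_inf S n) (translation k) \<and>
              law_invariant P (A_star_inf S N) (translation k) \<and>
              law_invariant P (A_dagger_inf S X (real n)) (translation k)) \<and>
         (\<forall>k. law_invariant P (A_fixed_inf S n) (reflection k) \<and>
              law_invariant P (A_star_inf S N) (reflection k) \<and>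
              law_invariant P (A_dagger_inf S X (real n)) (reflection k))"
proof -
  interpret prob_space P by fact
  let ?W = "\<lambda>(i, j). S i j"
  have W: "simple_random_walk P (start p) (?W p)" if "p \<in> particle_index" for p
    using assms(2) that by (auto simp: independent_walks_def particle_index_def start_def)
  have indep_W: "indep_vars (\<lambda>_. trajectory_space) ?W particle_index"
    using assms(2) by (simp add: independent_walks_def)

  have N: "poisson_distributed P (real n) (N i)" for i
    using assms(3) by (simp add: iid_poisson_indep_of_walks_def)
  have indep_N: "indep_vars (\<lambda>_. count_space UNIV) N UNIV"
    and N_W: "independent_of P (PiM UNIV (\<lambda>_. count_space UNIV)) (\<lambda>\<omega> i. N i \<omega>)
      walk_family_space (walk_family S)"
    using assms(3) by (auto simp: iid_poisson_indep_of_walks_def)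
  have N_meas: "(\<lambda>\<omega> i. N i \<omega>) \<in> P \<rightarrow>\<^sub>M PiM UNIV (\<lambda>_. count_space UNIV)"
    using N_W by (simp add: independent_of_def)

  \<comment> \<open>The counts behind the arrival order are those of the points up to time
    \<open>n\<close>; they are again i.i.d. Poisson with parameter \<open>n\<close>.\<close>
  define C where "C i \<omega> = card (X i \<omega> \<inter> {..real n})" for i \<omega>
  have PPP: "poisson_point_process P 1 (X i)" for i
    using assms(4) by (simp add: iid_poisson_processes_indep_of_walks_def)
  have indep_X: "indep_vars (\<lambda>_. point_space) X UNIV"
    and X_W: "independent_of P (PiM UNIV (\<lambda>_. point_space)) (\<lambda>\<omega> i. X i \<omega>)
      walk_family_space (walk_family S)"
    using assms(4) by (auto simp: iid_poisson_processes_indep_of_walks_def)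
  have X_meas: "(\<lambda>\<omega> i. X i \<omega>) \<in> P \<rightarrow>\<^sub>M PiM UNIV (\<lambda>_. point_space)"
    using X_W by (simp add: independent_of_def)
  have indep_C: "indep_vars (\<lambda>_. count_space UNIV) C UNIV"
    unfolding C_def[abs_def] using indep_X measurable_count_points by (rule indep_vars_compose2)
  have C: "poisson_distributed P (real n) (C i)" for i
  proof -
    have X_i: "X i \<in> P \<rightarrow>\<^sub>M point_space"
      using PPP[of i] by (simp add: poisson_point_process_def)
    have C_eq: "C i \<omega> = card (X i \<omega> \<inter> {0..real n})" if "\<omega> \<in> space P" for \<omega>
    proof -
      have "X i \<omega> \<inter> {..real n} = X i \<omega> \<inter> {0..real n}"
        using measurable_space[OF X_i that] by (auto simp: space_point_space point_configs_def)
      then show ?thesis by (simp add: C_def)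
    qed
    have "\<forall>B\<in>sets borel. bounded B \<and> B \<subseteq> {0..} \<longrightarrow>
        poisson_distributed P (1 * measure lborel B) (\<lambda>\<omega>. card (X i \<omega> \<inter> B))"
      using PPP[of i] unfolding poisson_point_process_def by blast
    from this[rule_format, of "{0..real n}"]
    have "poisson_distributed P (real n) (\<lambda>\<omega>. card (X i \<omega> \<inter> {0..real n}))"
      by simp
    then show ?thesis
      unfolding poisson_distributed_def
      using C_eq by (simp cong: measurable_cong conj_cong)
  qed
  have C_meas: "(\<lambda>\<omega> i. C i \<omega>) \<in> P \<rightarrow>\<^sub>M PiM UNIV (\<lambda>_. count_space UNIV)"
    using indep_C by (intro measurable_PiM_single') (auto simp: indep_vars_def)

  interpret const: ordered_aggregates P ?W "\<lambda>_ _. n" "\<lambda>m _. particles (\<lambda>_. n) m"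
  proof unfold_locales
    \<comment> \<open>A deterministic order makes the first event either everything or
      empty.\<close>
    show "emeasure P {\<omega> \<in> space P. particles (\<lambda>_. n) m = ps \<and> aggregate (\<lambda>p. ?W p \<omega>) ps \<in> B} =
      emeasure P {\<omega> \<in> space P. particles (\<lambda>_. n) m = ps} * emeasure P {\<omega> \<in> space P. aggregate (\<lambda>p. ?W p \<omega>) ps \<in> B}" for m ps B
      by (cases "particles (\<lambda>_. n) m = ps") (simp_all add: emeasure_space_1)
  qed (rule W indep_W filter_particles measurable_const refl | assumption | simp add: space_PiM)+

  interpret star: ordered_aggregates P ?W N "\<lambda>m \<omega>. particles (\<lambda>i. N i \<omega>) m"
  proof unfold_locales
    show "distr P (PiM UNIV (\<lambda>_. count_space UNIV)) (\<lambda>\<omega> i. N (\<sigma> i) \<omega>) =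
      distr P (PiM UNIV (\<lambda>_. count_space UNIV)) (\<lambda>\<omega> i. N i \<omega>)" if "bij \<sigma>" for \<sigma>
      using indep_N poisson_distributed_distr_eq[OF assms(1) N N] that by (rule distr_iid_reindex)
  qed (rule W indep_W filter_particles N_meas measurable_compose[OF N_meas measurable_particles]
      independent_order[OF assms(1) N_W measurable_particles] refl | assumption)+

  interpret dagger: ordered_aggregates P ?W C "\<lambda>m \<omega>. timed_particles (\<lambda>i. X i \<omega>) (real n) m"
  proof unfold_locales
    show "distr P (PiM UNIV (\<lambda>_. count_space UNIV)) (\<lambda>\<omega> i. C (\<sigma> i) \<omega>) =
      distr P (PiM UNIV (\<lambda>_. count_space UNIV)) (\<lambda>\<omega> i. C i \<omega>)" if "bij \<sigma>" for \<sigma>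
      using indep_C poisson_distributed_distr_eq[OF assms(1) C C] that by (rule distr_iid_reindex)
    \<comment> \<open>Sorting by arrival time only permutes the particles.\<close>
    show "mset (timed_particles (\<lambda>i. X i \<omega>) (real n) m) = mset (particles (\<lambda>i. C i \<omega>) m)" for m \<omega>
      by (simp add: timed_particles_def C_def)
  qed (rule W indep_W filter_timed_particles C_meas measurable_compose[OF X_meas measurable_timed_particles]
      independent_order[OF assms(1) X_W measurable_timed_particles] | assumption)+

  have W_eq: "(\<lambda>p. ?W p \<omega>) = (\<lambda>(i, j). S i j \<omega>)" for \<omega>
    by (simp add: fun_eq_iff)
  show ?thesis
    using const.law_invariant_translation_reflection[of "A_fixed_inf S n"]
      star.law_invariant_translation_reflection[of "A_star_inf S N"]
      dagger.law_invariant_translation_reflection[of "A_dagger_inf S X (real n)"]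
    by (simp add: A_fixed_inf_def A_fixed_def A_star_inf_def A_star_def A_dagger_inf_def A_dagger_def
        const.agg_def star.agg_def dagger.agg_def W_eq)
qed

end
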